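(* Let $\mathcal{G}\subseteq\mathcal{G}_\infty$ be a closed graph class. The following are equivalent. (1) There is $H\in\mathcal{G}_\infty$ which contains $\mathcal{G}$. (2) $\mathcal{G}^\bullet$ is $\sigma$-compact. (3) $T(\mathcal{G})$ contains no subdivision of $T_\infty$.
   Context: All graphs are simple, connected (in particular nonempty) and countable. A graph is locally finite if all its vertices have finite degree; $\mathcal{G}_\infty$ is the class of all connected, locally finite graphs. A graph class is a class of graphs closed under isomorphism. A graph $H$ contains $\mathcal{G}$ if every $G\in\mathcal{G}$ is isomorphic to a subgraph of $H$. A rooted graph is a pair $(G,v)$ with $G$ a graph and $v\in V(G)$; isomorphisms of rooted graphs map root to root, and rooted graphs are considered up to isomorphism. For a graph class $\mathcal{G}$, $\mathcal{G}^\bullet=\{(G,v)\mid G\in\mathcal{G},\ v\in V(G)\}$. Write $\mathbb{N}=\{1,2,\dots\}$ and $\mathbb{N}_0=\mathbb{N}\cup\{0\}$. $B_G(v,r)$ is the ball of radius $r$ and centre $v$ in $G$, i.e. the subgraph induced by the vertices at distance at most $r$ from $v$, with distinguished vertex $v$; isomorphisms of balls are required to map centre to centre. Any class of rooted graphs is endowed with the metric $d((G,v),(G',v'))=\exp(-\max\{r\in\mathbb{N}_0\mid B_G(v,r)\text{ is isomorphic to }B_{G'}(v',r)\})$ (with distance $0$ if the balls are isomorphic for all $r$) and the topology it induces. A class $\mathcal{G}\subseteq\mathcal{G}_\infty$ is closed if $\mathcal{G}^\bullet$ is a closed subset of $\mathcal{G}_\infty^\bullet$. A topological space is $\sigma$-compact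 if it can be covered by countably many compact subsets. $T(\mathcal{G})$ is the tree with vertex set $\{B_G(v,r)\mid G\in\mathcal{G},\ v\in V(G),\ r\in\mathbb{N}_0\}$, where $B_G(v,r)$ and $B_{G'}(v',r)$ (same $r$) are considered the same if there is an isomorphism between them mapping $v$ to $v'$, while balls of different radii are always considered different; $B_G(v,r-1)$ and $B_G(v,r)$ are connected by an edge for every $G\in\mathcal{G}$, $v\in V(G)$, $r\in\mathbb{N}$. $T_\infty$ denotes the tree in which every vertex has countably infinite degree. *)

theory Defs
  imports "HOL-Analysis.Analysis" "HOL-Library.Extended_Nat" "HOL-Library.Countable_Set"
begin

section \<open>Graphs\<close>

record 'a ugraph =
  verts :: "'a set"
  edges :: "'a set set"

definition simple_graph :: "'a ugraph \<Rightarrow> bool" where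
  "simple_graph G \<longleftrightarrow> (\<forall>e\<in>edges G. e \<subseteq> verts G \<and> card e = 2)"

definition walk :: "'a ugraph \<Rightarrow> 'a list \<Rightarrow> bool" where
  "walk G p \<longleftrightarrow> p \<noteq> [] \<and> set p \<subseteq> verts G \<and> successively (\<lambda>u v. {u, v} \<in> edges G) p"

definition simple_path :: "'a ugraph \<Rightarrow> 'a list \<Rightarrow> bool" where
  "simple_path G p \<longleftrightarrow> walk G p \<and> distinct p"

definition connected_graph :: "'a ugraph \<Rightarrow> bool" where
  "connected_graph G \<longleftrightarrow> verts G \<noteq> {} \<and>
     (\<forall>u\<in>verts G. \<forall>v\<in>verts G. \<exists>p. walk G p \<and> hd p = u \<and> last p = v)"

definition neighbours :: "'a ugraph \<Rightarrow> 'a \<Rightarrow> 'a set" where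
  "neighbours G v = {u. {u, v} \<in> edges G}"

definition locally_finite_graph :: "'a ugraph \<Rightarrow> bool" where
  "locally_finite_graph G \<longleftrightarrow> (\<forall>v\<in>verts G. finite (neighbours G v))"

definition cycle :: "'a ugraph \<Rightarrow> 'a list \<Rightarrow> bool" where
  "cycle G c \<longleftrightarrow> simple_path G c \<and> length c \<ge> 3 \<and> {last c, hd c} \<in> edges G"

definition tree_graph :: "'a ugraph \<Rightarrow> bool" where
  "tree_graph G \<longleftrightarrow> simple_graph G \<and> connected_graph G \<and> (\<nexists>c. cycle G c)"

definition graph_iso :: "('a \<Rightarrow> 'b) \<Rightarrow> 'a ugraph \<Rightarrow> 'b ugraph \<Rightarrow> bool" where
  "graph_iso f G H \<longleftrightarrow> bij_betw f (verts G) (verts H) \<and> edges H = (\<lambda>e. f ` e) ` edges G"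

definition isomorphic_graphs :: "'a ugraph \<Rightarrow> 'b ugraph \<Rightarrow> bool" where
  "isomorphic_graphs G H \<longleftrightarrow> (\<exists>f. graph_iso f G H)"

definition subgraph :: "'a ugraph \<Rightarrow> 'a ugraph \<Rightarrow> bool" where
  "subgraph S G \<longleftrightarrow> simple_graph S \<and> verts S \<subseteq> verts G \<and> edges S \<subseteq> edges G"

definition induced_subgraph :: "'a ugraph \<Rightarrow> 'a set \<Rightarrow> 'a ugraph" where
  "induced_subgraph G W = \<lparr>verts = verts G \<inter> W, edges = {e \<in> edges G. e \<subseteq> W}\<rparr>"

definition graph_dist :: "'a ugraph \<Rightarrow> 'a \<Rightarrow> 'a \<Rightarrow> enat" where
  "graph_dist G u v = (INF p \<in> {p. walk G p \<and> hd p = u \<and> last p = v}. enat (length p - 1))"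

text \<open>Every countable graph is isomorphic to one with vertices in \<^typ>\<open>nat\<close>, so a class of
  countable graphs closed under isomorphism is the same thing as an isomorphism-closed set of
  graphs with vertices in \<^typ>\<open>nat\<close>.\<close>

definition G_inf :: "nat ugraph set" where
  "G_inf = {G. simple_graph G \<and> connected_graph G \<and> locally_finite_graph G}"

definition graph_class :: "nat ugraph set \<Rightarrow> bool" where
  "graph_class \<G> \<longleftrightarrow> (\<forall>G\<in>\<G>. simple_graph G \<and> connected_graph G) \<and>
     (\<forall>G\<in>\<G>. \<forall>H. isomorphic_graphs G H \<longrightarrow> H \<in> \<G>)"

definition contains_class :: "nat ugraph \<Rightarrow> nat ugraph set \<Rightarrow> bool" where
  "contains_class H \<G> \<longleftrightarrow> (\<forall>G\<in>\<G>. \<exists>S. subgraph S H \<and> isomorphic_graphs G S)"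

section \<open>Rooted graphs up to isomorphism\<close>

type_synonym rgraph = "nat ugraph \<times> nat"

definition rooted_graphs :: "rgraph set" where
  "rooted_graphs = {(G, v). simple_graph G \<and> v \<in> verts G}"

definition rooted_iso :: "(rgraph \<times> rgraph) set" where
  "rooted_iso = {((G, v), (H, w)). (G, v) \<in> rooted_graphs \<and> (H, w) \<in> rooted_graphs \<and>
     (\<exists>f. graph_iso f G H \<and> f v = w)}"

definition rooted_class :: "nat ugraph set \<Rightarrow> rgraph set set" where
  "rooted_class \<G> = {(G, v). G \<in> \<G> \<and> v \<in> verts G} // rooted_iso"

definition graph_ball :: "rgraph \<Rightarrow> nat \<Rightarrow> rgraph" where
  "graph_ball = (\<lambda>(G, v) r. (induced_subgraph G {u. graph_dist G v u \<le> enat r}, v))"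

definition pre_rooted_dist :: "rgraph \<Rightarrow> rgraph \<Rightarrow> real" where
  "pre_rooted_dist x y =
     (if \<forall>r. (graph_ball x r, graph_ball y r) \<in> rooted_iso then 0
      else exp (- real (Max {r. (graph_ball x r, graph_ball y r) \<in> rooted_iso})))"

text \<open>The choice of representatives is immaterial, see \<open>rooted_dist_class\<close> below.\<close>

definition rooted_dist :: "rgraph set \<Rightarrow> rgraph set \<Rightarrow> real" where
  "rooted_dist X Y = pre_rooted_dist (SOME x. x \<in> X) (SOME y. y \<in> Y)"

definition rooted_topology :: "nat ugraph set \<Rightarrow> rgraph set topology" where
  "rooted_topology \<G> = Metric_space.mtopology (rooted_class \<G>) rooted_dist"

definition closed_graph_class :: "nat ugraph set \<Rightarrow> bool" where
  "closed_graph_class \<G> \<longleftrightarrow> closedin (rooted_topology G_inf) (rooted_class \<G>)"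

definition sigma_compact_space :: "'a topology \<Rightarrow> bool" where
  "sigma_compact_space X \<longleftrightarrow>
     (\<exists>\<K>. countable \<K> \<and> (\<forall>K\<in>\<K>. compactin X K) \<and> topspace X \<subseteq> \<Union>\<K>)"

section \<open>The tree of balls\<close>

text \<open>The radius is part of the vertex, so that balls of different radii are always different,
  even when they are isomorphic.\<close>

type_synonym ball_type = "nat \<times> rgraph set"

definition ball_type :: "nat ugraph \<Rightarrow> nat \<Rightarrow> nat \<Rightarrow> ball_type" where
  "ball_type G v r = (r, rooted_iso `` {graph_ball (G, v) r})"

definition ball_tree :: "nat ugraph set \<Rightarrow> ball_type ugraph" where
  "ball_tree \<G> =
     \<lparr>verts = {ball_type G v r | G v r. G \<in> \<G> \<and> v \<in> verts G},
      edges = {{ball_type G v (r - 1), ball_type G v r} | G v r. G \<in> \<G> \<and> v \<in> verts G \<and> r \<ge> 1}\<rparr>"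

section \<open>Subdivisions of the infinite-degree tree\<close>

definition interior_verts :: "'a list \<Rightarrow> 'a set" where
  "interior_verts p = set (butlast (tl p))"

definition path_edges :: "'a list \<Rightarrow> 'a set set" where
  "path_edges p = {{p ! i, p ! Suc i} | i. Suc i < length p}"

text \<open>\<open>S\<close> arises from \<open>X\<close> by replacing each edge \<open>e\<close> by a path \<open>P e\<close> of length at least 1 between
  the images of its ends, the paths being internally disjoint and no interior meeting a branch
  vertex. The length is at least 1 because \<open>\<phi>\<close> is injective.\<close>

definition is_subdivision :: "'a ugraph \<Rightarrow> 'b ugraph \<Rightarrow> bool" where
  "is_subdivision S X \<longleftrightarrow>
     (\<exists>\<phi> P. inj_on \<phi> (verts X) \<and>
        (\<forall>e\<in>edges X. simple_path S (P e) \<and> {hd (P e), last (P e)} = \<phi> ` e \<and>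
           interior_verts (P e) \<inter> \<phi> ` verts X = {}) \<and>
        (\<forall>e\<in>edges X. \<forall>e'\<in>edges X. e \<noteq> e' \<longrightarrow> interior_verts (P e) \<inter> interior_verts (P e') = {}) \<and>
        verts S = \<phi> ` verts X \<union> (\<Union>e\<in>edges X. set (P e)) \<and>
        edges S = (\<Union>e\<in>edges X. path_edges (P e)))"

definition contains_subdivision :: "'a ugraph \<Rightarrow> 'b ugraph \<Rightarrow> bool" where
  "contains_subdivision G X \<longleftrightarrow> (\<exists>S. subgraph S G \<and> is_subdivision S X)"

text \<open>The tree in which every vertex has countably infinite degree (unique up to isomorphism),
  realised on finite sequences, the neighbours of a sequence being its one-element extensions and
  its tail; see \<open>tree_T_inf\<close> and \<open>degree_T_inf\<close>.\<close>

definition T_inf :: "nat list ugraph" where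
  "T_inf = \<lparr>verts = UNIV, edges = {{xs, n # xs} | n xs. True}\<rparr>"

section \<open>Basic facts\<close>

lemma T_inf_edge_iff:
  "{u, v} \<in> edges T_inf \<longleftrightarrow> (\<exists>n. v = n # u) \<or> (\<exists>n. u = n # v)"
  unfolding T_inf_def by (auto simp: doubleton_eq_iff)

lemma T_inf_edge_longer: "{u, v} \<in> edges T_inf \<Longrightarrow> length u \<le> length v \<Longrightarrow> u = tl v"
  by (auto simp: T_inf_edge_iff)

lemma walk_T_inf_to_root: "\<exists>p. walk T_inf p \<and> hd p = u \<and> last p = []"
proof (induction u)
  case Nil
  have "walk T_inf [[]]" by (auto simp: walk_def T_inf_def)
  then show ?case by force
next
  case (Cons a u)
  then obtain p where p: "walk T_inf p" "hd p = u" "last p = []" by blast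
  then have "walk T_inf ((a # u) # p)"
    by (auto simp: walk_def successively_Cons T_inf_edge_iff) (auto simp: T_inf_def)
  with p show ?case by (intro exI[of _ "(a # u) # p"]) (auto simp: walk_def)
qed

lemma connected_T_inf: "connected_graph T_inf"
  unfolding connected_graph_def
proof (intro conjI ballI)
  show "verts T_inf \<noteq> {}" by (simp add: T_inf_def)
next
  fix u v
  obtain p q where p: "walk T_inf p" "hd p = u" "last p = []"
    and q: "walk T_inf q" "hd q = v" "last q = []"
    using walk_T_inf_to_root by metis
  let ?w = "p @ tl (rev q)"
  have q': "rev q = [] # tl (rev q)"
    using q by (metis hd_rev list.collapse rev_is_Nil_conv walk_def)
  have sq: "successively (\<lambda>u v. {u, v} \<in> edges T_inf) (rev q)"
    using q by (simp add: walk_def insert_commute)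
  then have "successively (\<lambda>u v. {u, v} \<in> edges T_inf) ([] # tl (rev q))"
    by (subst q'[symmetric])
  then have "walk T_inf ?w"
    using p by (auto simp: walk_def successively_append_iff successively_Cons) (auto simp: T_inf_def)
  moreover have "hd ?w = u" using p by (auto simp: walk_def)
  moreover have "last ?w = v"
  proof -
    have "last (rev q) = v" using q by (simp add: last_rev)
    then show ?thesis using q' p by (metis last_ConsL last_ConsR last_appendL last_appendR)
  qed
  ultimately show "\<exists>p. walk T_inf p \<and> hd p = u \<and> last p = v" by blast
qed

lemma walk_nth: "walk G p \<Longrightarrow> Suc i < length p \<Longrightarrow> {p ! i, p ! Suc i} \<in> edges G"
  by (simp add: walk_def successively_conv_nth)

lemma cycle_nth:
  assumes "cycle G c" "i < length c"
  shows "{c ! i, c ! (Suc i mod length c)} \<in> edges G"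
proof (cases "Suc i < length c")
  case True
  then show ?thesis using assms walk_nth[of G c i] by (simp add: cycle_def simple_path_def)
next
  case False
  then have "i = length c - 1" "Suc i = length c" "c \<noteq> []" using assms by auto
  then show ?thesis using assms by (simp add: cycle_def last_conv_nth hd_conv_nth)
qed

lemma acyclic_T_inf: "\<not> cycle T_inf c"
proof
  assume c: "cycle T_inf c"
  let ?n = "length c"
  have n: "?n \<ge> 3" and d: "distinct c" using c by (auto simp: cycle_def simple_path_def)
  define l where "l = Max ((\<lambda>i. length (c ! i)) ` {..<?n})"
  have "l \<in> (\<lambda>i. length (c ! i)) ` {..<?n}"
    unfolding l_def using n by (intro Max_in) (auto simp: lessThan_empty_iff)
  then obtain i where i: "i < ?n" "length (c ! i) = l" by auto
  have max: "length (c ! j) \<le> length (c ! i)" if "j < ?n" for j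
    unfolding i l_def using that by (intro Max_ge) auto
  define j where "j = Suc i mod ?n"
  define k where "k = (if i = 0 then ?n - 1 else i - 1)"
  have j: "j < ?n" and k: "k < ?n" and ki: "Suc k mod ?n = i"
    using n i by (auto simp: j_def k_def intro: mod_less_divisor)
  have jk: "j \<noteq> k"
    using n i by (cases "Suc i = ?n") (auto simp: j_def k_def split: if_splits)
  have "{c ! i, c ! j} \<in> edges T_inf" "{c ! k, c ! i} \<in> edges T_inf"
    using cycle_nth[OF c i(1)] cycle_nth[OF c k] ki by (auto simp: j_def)
  then have "c ! j = tl (c ! i)" "c ! k = tl (c ! i)"
    using T_inf_edge_longer max j k by (metis insert_commute)+
  then have "c ! j = c ! k" by simp
  then show False using d j k jk by (simp add: nth_eq_iff_index_eq)
qed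

lemma tree_T_inf: "tree_graph T_inf"
  unfolding tree_graph_def
  using connected_T_inf acyclic_T_inf by (auto simp: simple_graph_def T_inf_def)

lemma degree_T_inf: "infinite (neighbours T_inf v)" "countable (neighbours T_inf v)"
proof -
  have "(\<lambda>n. n # v) ` UNIV \<subseteq> neighbours T_inf v"
    by (auto simp: neighbours_def T_inf_edge_iff)
  moreover have "infinite (range (\<lambda>n::nat. n # v))"
    by (intro range_inj_infinite) (auto simp: inj_def)
  ultimately show "infinite (neighbours T_inf v)" using infinite_super by blast
qed simp

lemma graph_iso_inv:
  assumes f: "graph_iso f G H" and G: "simple_graph G"
  shows "graph_iso (inv_into (verts G) f) H G"
proof -
  let ?g = "inv_into (verts G) f"
  have b: "bij_betw f (verts G) (verts H)" and e: "edges H = (\<lambda>e. f ` e) ` edges G"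
    using f by (auto simp: graph_iso_def)
  have "?g ` f ` e = e" if "e \<in> edges G" for e
    using that G b by (auto simp: simple_graph_def bij_betw_def intro!: inv_into_image_cancel)
  then have "(\<lambda>e. ?g ` e) ` edges H = edges G" unfolding e by (force simp: image_image)
  then show ?thesis using b by (simp add: graph_iso_def bij_betw_inv_into)
qed

lemma graph_iso_comp:
  "graph_iso f G H \<Longrightarrow> graph_iso g H K \<Longrightarrow> graph_iso (g \<circ> f) G K"
  by (auto simp: graph_iso_def bij_betw_trans image_image image_comp)

lemma equiv_rooted_iso: "equiv rooted_graphs rooted_iso"
proof (rule equivI)
  show "rooted_iso \<subseteq> rooted_graphs \<times> rooted_graphs" by (auto simp: rooted_iso_def)
  have "graph_iso id G G" for G :: "nat ugraph" by (auto simp: graph_iso_def)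
  then show "refl_on rooted_graphs rooted_iso"
    by (force simp: refl_on_def rooted_iso_def)
  show "sym rooted_iso"
  proof (rule symI)
    fix x y assume "(x, y) \<in> rooted_iso"
    then obtain G v H w f where xy: "x = (G, v)" "y = (H, w)" "x \<in> rooted_graphs" "y \<in> rooted_graphs"
      "graph_iso f G H" "f v = w" by (auto simp: rooted_iso_def)
    then have "graph_iso (inv_into (verts G) f) H G"
      by (auto simp: rooted_graphs_def intro: graph_iso_inv)
    moreover have "inv_into (verts G) f w = v"
      using xy by (auto simp: rooted_graphs_def graph_iso_def bij_betw_def)
    ultimately show "(y, x) \<in> rooted_iso" using xy unfolding rooted_iso_def by blast
  qed
  show "trans rooted_iso"
  proof (rule transI)
    fix x y z assume "(x, y) \<in> rooted_iso" "(y, z) \<in> rooted_iso"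
    then show "(x, z) \<in> rooted_iso"
      unfolding rooted_iso_def using graph_iso_comp by fastforce
  qed
qed

lemma graph_iso_walk: "graph_iso f G H \<Longrightarrow> walk G p \<Longrightarrow> walk H (map f p)"
proof -
  assume f: "graph_iso f G H" and p: "walk G p"
  have e: "{f u, f v} \<in> edges H" if "{u, v} \<in> edges G" for u v
  proof -
    have "f ` {u, v} \<in> edges H" using f that unfolding graph_iso_def by blast
    then show ?thesis by simp
  qed
  have "successively (\<lambda>u v. {f u, f v} \<in> edges H) p"
    using p e by (auto simp: walk_def intro: successively_mono)
  then show ?thesis
    using f p unfolding walk_def successively_map graph_iso_def bij_betw_def
    by (simp add: image_subset_iff) blast
qed

lemma graph_iso_dist_le:
  assumes "graph_iso f G H"
  shows "graph_dist H (f u) (f v) \<le> graph_dist G u v"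
  unfolding graph_dist_def
proof (rule INF_mono)
  fix p assume "p \<in> {p. walk G p \<and> hd p = u \<and> last p = v}"
  then show "\<exists>q\<in>{p. walk H p \<and> hd p = f u \<and> last p = f v}. enat (length q - 1) \<le> enat (length p - 1)"
    using graph_iso_walk[OF assms]
    by (intro bexI[of _ "map f p"]) (auto simp: walk_def hd_map last_map)
qed

lemma graph_iso_dist:
  assumes f: "graph_iso f G H" and G: "simple_graph G" and uv: "u \<in> verts G" "v \<in> verts G"
  shows "graph_dist H (f u) (f v) = graph_dist G u v"
proof (rule antisym)
  have "inv_into (verts G) f (f x) = x" if "x \<in> verts G" for x
    using f that by (simp add: graph_iso_def bij_betw_def)
  then show "graph_dist G u v \<le> graph_dist H (f u) (f v)"
    using graph_iso_dist_le[OF graph_iso_inv[OF f G], of "f u" "f v"] uv by simp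
qed (rule graph_iso_dist_le[OF f])

lemma graph_dist_self: "v \<in> verts G \<Longrightarrow> graph_dist G v v = 0"
proof -
  assume v: "v \<in> verts G"
  have "graph_dist G v v \<le> enat (length [v] - 1)"
    unfolding graph_dist_def using v by (intro INF_lower) (auto simp: walk_def)
  then show ?thesis by (simp add: zero_enat_def[symmetric])
qed

lemma graph_ball_rooted: "x \<in> rooted_graphs \<Longrightarrow> graph_ball x r \<in> rooted_graphs"
  by (cases x) (simp add: rooted_graphs_def graph_ball_def induced_subgraph_def simple_graph_def graph_dist_self)

lemma graph_ball_iso:
  assumes "(x, y) \<in> rooted_iso"
  shows "(graph_ball x r, graph_ball y r) \<in> rooted_iso"
proof -
  obtain G v H w f where xy: "x = (G, v)" "y = (H, w)" "x \<in> rooted_graphs" "y \<in> rooted_graphs"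
    and f: "graph_iso f G H" "f v = w" using assms by (auto simp: rooted_iso_def)
  have G: "simple_graph G" "v \<in> verts G" using xy by (auto simp: rooted_graphs_def)
  let ?A = "{u. graph_dist G v u \<le> enat r}" and ?B = "{u. graph_dist H w u \<le> enat r}"
  have AB: "f u \<in> ?B \<longleftrightarrow> u \<in> ?A" if "u \<in> verts G" for u
    using graph_iso_dist[OF f(1) G(1) G(2) that] f(2) by simp
  have b: "inj_on f (verts G)" "f ` verts G = verts H" and e: "edges H = (\<lambda>e. f ` e) ` edges G"
    using f by (auto simp: graph_iso_def bij_betw_def)
  have "bij_betw f (verts G \<inter> ?A) (verts H \<inter> ?B)"
    unfolding bij_betw_def b(2)[symmetric] using AB by (auto intro: inj_on_subset[OF b(1)])
  moreover have "f ` e \<subseteq> ?B \<longleftrightarrow> e \<subseteq> ?A" if "e \<in> edges G" for e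
    using AB that G(1) unfolding simple_graph_def by blast
  then have "{e \<in> edges H. e \<subseteq> ?B} = (\<lambda>e. f ` e) ` {e \<in> edges G. e \<subseteq> ?A}"
    unfolding e by auto
  ultimately have "graph_iso f (induced_subgraph G ?A) (induced_subgraph H ?B)"
    by (simp add: graph_iso_def induced_subgraph_def)
  then show ?thesis
    using graph_ball_rooted[OF xy(3), of r] graph_ball_rooted[OF xy(4), of r] xy(1,2) f(2)
    by (auto simp: rooted_iso_def graph_ball_def)
qed

lemma rooted_dist_class:
  assumes "x \<in> rooted_graphs" "y \<in> rooted_graphs"
  shows "rooted_dist (rooted_iso `` {x}) (rooted_iso `` {y}) = pre_rooted_dist x y"
proof -
  note E = equiv_rooted_iso
  let ?x = "SOME z. z \<in> rooted_iso `` {x}" and ?y = "SOME z. z \<in> rooted_iso `` {y}"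
  have "?x \<in> rooted_iso `` {x}" "?y \<in> rooted_iso `` {y}"
    using assms E by (metis equiv_class_self someI)+
  then have xy: "(x, ?x) \<in> rooted_iso" "(y, ?y) \<in> rooted_iso" by auto
  have "(graph_ball ?x r, graph_ball ?y r) \<in> rooted_iso \<longleftrightarrow>
        (graph_ball x r, graph_ball y r) \<in> rooted_iso" for r
    using graph_ball_iso[OF xy(1), of r] graph_ball_iso[OF xy(2), of r] E
    by (meson equivE symE transE)
  then show ?thesis by (simp add: rooted_dist_def pre_rooted_dist_def)
qed

end

theory Submission
  imports Defs "HOL-Library.Sublist"
begin

text \<open>Both (1) and (2) are equivalent to the existence of countably many functions \<open>N n\<close> such that for
  every rooted graph of the class the ball sizes are bounded by some \<open>N n\<close>. For (1), \<open>N n\<close> is read off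
  from the balls around the vertex \<open>n\<close> of \<open>H\<close>; conversely one takes for \<open>H\<close> a graph with finite layers,
  complete inside each layer and between consecutive layers, and maps the distance classes of the
  \<open>n\<close>-th kind of rooted graphs to the layers from the \<open>n\<close>-th on. For (2), the rooted graphs bounded
  by \<open>N n\<close> form a compact set since the class is closed, and ball sizes are bounded on compact sets.

  The tree of balls enters through the topology only: rooted graphs are its rays, by Koenig's lemma
  and closedness, and basic open sets are the sets of rays through a vertex. If the tree has a
  subdivision of \<open>T_inf\<close>, a ray can be steered out of countably many compact sets one after another.
  If the space is not sigma-compact, the vertices whose cylinder is not sigma-compact branch
  infinitely often, which yields a subdivision.\<close>

section \<open>Systems of ball types\<close>

text \<open>Size bounds are the right currency because only finitely many ball types have a given
  radius and at most a given size. A bound \<open>N n\<close> therefore cuts the tree of balls down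
  to a locally finite one, and the rays of such a tree form a compact set; countably many bounds
  give sigma-compactness. Serving countably many bounds by one locally finite graph requires the
  shift by \<open>n\<close>: layer \<open>r\<close> has to make room only for the bounds
  \<open>N n\<close> with \<open>n \<le> r\<close>, a finite number. Finite balls that fit together
  always have a limit in \<open>G_inf\<close>. Closedness of the class enters to place this limit in
  the class again, so that every ray is a point of the space. All arguments about rays run in
  abstract locales. What graphs contribute is coherence of ball types, realisation of rays,
  finiteness of the types of bounded size and, for comparing the metric with cylinders, the fact
  that a rooted member of \<open>G_inf\<close> is determined by its balls.\<close>

text \<open>Here \<open>x\<close> stands for a rooted graph up to isomorphism, \<open>b x r\<close> for the type of its ball of
  radius \<open>r\<close>, and \<open>lev\<close> recovers the radius from the type.\<close>

locale ball_system =
  fixes X :: "'x set" and b :: "'x \<Rightarrow> nat \<Rightarrow> 't" and lev :: "'t \<Rightarrow> nat"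
  assumes lev: "x \<in> X \<Longrightarrow> lev (b x r) = r"
    and coherent: "x \<in> X \<Longrightarrow> y \<in> X \<Longrightarrow> b x (Suc r) = b y (Suc r) \<Longrightarrow> b x r = b y r"
    and root: "x \<in> X \<Longrightarrow> y \<in> X \<Longrightarrow> b x 0 = b y 0"
begin

definition types :: "'t set" where
  "types = {b x r | x r. x \<in> X}"

definition cylinder :: "'x \<Rightarrow> nat \<Rightarrow> 'x set" where
  "cylinder x r = {y \<in> X. b y r = b x r}"

definition cylinder_open :: "'x set \<Rightarrow> bool" where
  "cylinder_open U \<longleftrightarrow> U \<subseteq> X \<and> (\<forall>x\<in>U. \<exists>r. cylinder x r \<subseteq> U)"

definition cylinder_topology :: "'x topology" where
  "cylinder_topology = topology cylinder_open"

text \<open>What remains of a subdivision of \<open>T_inf\<close> when only its branch vertices are recorded: each of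
  them has infinitely many children below further branch vertices.\<close>

definition branching :: "'t set \<Rightarrow> bool" where
  "branching U \<longleftrightarrow> U \<noteq> {} \<and> U \<subseteq> types \<and>
     (\<forall>u\<in>U. infinite {b x (Suc (lev u)) | x. x \<in> X \<and> b x (lev u) = u \<and> (\<exists>s>lev u. b x s \<in> U)})"

section \<open>Cylinders, their topology and the metrics that induce it\<close>

lemma coherent_le:
  assumes "x \<in> X" "y \<in> X" "b x s = b y s" "r \<le> s"
  shows "b x r = b y r"
  using assms(4,3) by (induction rule: inc_induct) (auto intro: coherent assms)

lemma cylinder_antimono: "x \<in> X \<Longrightarrow> r \<le> s \<Longrightarrow> cylinder x s \<subseteq> cylinder x r"
  by (auto simp: cylinder_def intro: coherent_le)

lemma openin_cylinder_topology: "openin cylinder_topology U \<longleftrightarrow> cylinder_open U"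
proof -
  have "istopology cylinder_open"
    unfolding istopology_def
  proof (intro conjI allI impI)
    fix S T assume S: "cylinder_open S" and T: "cylinder_open T"
    show "cylinder_open (S \<inter> T)"
      unfolding cylinder_open_def
    proof (intro conjI ballI)
      show "S \<inter> T \<subseteq> X" using S by (auto simp: cylinder_open_def)
      fix x assume x: "x \<in> S \<inter> T"
      then obtain r s where rs: "cylinder x r \<subseteq> S" "cylinder x s \<subseteq> T" "x \<in> X"
        using S T by (fastforce simp: cylinder_open_def)
      then have "cylinder x (max r s) \<subseteq> S \<inter> T"
        using cylinder_antimono[of x r "max r s"] cylinder_antimono[of x s "max r s"] by auto
      then show "\<exists>r. cylinder x r \<subseteq> S \<inter> T" by blast
    qed
  next
    fix \<K> assume K: "\<forall>K\<in>\<K>. cylinder_open K"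
    show "cylinder_open (\<Union>\<K>)"
      unfolding cylinder_open_def
    proof (intro conjI ballI)
      show "\<Union>\<K> \<subseteq> X" using K by (auto simp: cylinder_open_def)
      fix x assume "x \<in> \<Union>\<K>"
      then obtain K r where "K \<in> \<K>" "cylinder x r \<subseteq> K" using K by (force simp: cylinder_open_def)
      then show "\<exists>r. cylinder x r \<subseteq> \<Union>\<K>" by blast
    qed
  qed
  then show ?thesis by (simp add: cylinder_topology_def)
qed

lemma openin_cylinder: "openin cylinder_topology (cylinder x r)"
proof -
  have "cylinder y r \<subseteq> cylinder x r" if "y \<in> cylinder x r" for y
    using that by (auto simp: cylinder_def)
  moreover have "cylinder x r \<subseteq> X" by (auto simp: cylinder_def)
  ultimately show ?thesis unfolding openin_cylinder_topology cylinder_open_def by blast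
qed

lemma topspace_cylinder_topology [simp]: "topspace cylinder_topology = X"
proof
  show "topspace cylinder_topology \<subseteq> X"
    using openin_topspace[of cylinder_topology]
    unfolding openin_cylinder_topology cylinder_open_def by blast
  have "cylinder_open X" by (auto simp: cylinder_open_def cylinder_def)
  then show "X \<subseteq> topspace cylinder_topology"
    by (simp add: openin_subset openin_cylinder_topology)
qed

text \<open>Everything rests on \<open>le_iff\<close>: the closed ball of radius
  \<open>exp (- real r)\<close> around a point is its cylinder at \<open>r\<close>. Nonnegativity
  and symmetry are assumed on the whole type because \<open>Metric_space\<close> demands them there,
  while the formula for \<open>d\<close> makes sense only on \<open>X\<close>.\<close>

lemma ultrametric:
  fixes d :: "'x \<Rightarrow> 'x \<Rightarrow> real"
  assumes nonneg: "\<And>x y. 0 \<le> d x y" and commute: "\<And>x y. d x y = d y x"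
    and d: "\<And>x y. x \<in> X \<Longrightarrow> y \<in> X \<Longrightarrow>
      d x y = (if \<forall>r. b x r = b y r then 0 else exp (- real (Max {r. b x r = b y r})))"
    and separated: "\<And>x y. x \<in> X \<Longrightarrow> y \<in> X \<Longrightarrow> (\<And>r. b x r = b y r) \<Longrightarrow> x = y"
  shows "Metric_space X d" and "Metric_space.mtopology X d = cylinder_topology"
proof -
  have le_iff: "d x y \<le> exp (- real r) \<longleftrightarrow> b x r = b y r" if xy: "x \<in> X" "y \<in> X" for x y r
  proof (cases "\<forall>r. b x r = b y r")
    case True
    then show ?thesis using d[OF xy] by simp
  next
    case False
    then obtain s where s: "b x s \<noteq> b y s" by blast
    let ?A = "{r. b x r = b y r}"
    have "?A \<subseteq> {..<s}" using s coherent_le[OF xy] by (metis (mono_tags) lessThan_iff linorder_not_less mem_Collect_eq subsetI)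
    then have fin: "finite ?A" using finite_subset by blast
    \<comment> \<open>Agreement at radius 0 keeps \<open>Max\<close> from being applied to the empty
      set.\<close>
    have ne: "?A \<noteq> {}" using root[OF xy] by blast
    have "d x y \<le> exp (- real r) \<longleftrightarrow> r \<le> Max ?A" using d[OF xy] False by simp
    also have "\<dots> \<longleftrightarrow> r \<in> ?A"
      using Max_in[OF fin ne] Max_ge[OF fin] coherent_le[OF xy] by blast
    finally show ?thesis by simp
  qed
  have d_cases: "d x y = 0 \<or> (\<exists>m::nat. d x y = exp (- real m))" if "x \<in> X" "y \<in> X" for x y
    using d[OF that] by auto
  show M: "Metric_space X d"
  proof
    show "d x y = 0 \<longleftrightarrow> x = y" if "x \<in> X" "y \<in> X" for x y
      using d[OF that] separated[OF that] by auto
    fix x y z assume xyz: "x \<in> X" "y \<in> X" "z \<in> X"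
    let ?m = "max (d x y) (d y z)"
    \<comment> \<open>The larger distance is again 0 or of the form \<open>exp (- real m)\<close>,
      and at values of the latter form \<open>le_iff\<close> turns the ultrametric inequality into
      transitivity of equality.\<close>
    have "?m = 0 \<or> (\<exists>m::nat. ?m = exp (- real m))"
      using d_cases[OF xyz(1,2)] d_cases[OF xyz(2,3)] by (auto simp: max_def)
    then have "d x z \<le> ?m"
    proof
      assume m: "?m = 0"
      then have "d x y \<le> 0" "d y z \<le> 0" by linarith+
      then have "d x y = 0" "d y z = 0" using nonneg by (simp_all add: antisym)
      then have "b x r = b z r" for r
        using d[OF xyz(1,2)] d[OF xyz(2,3)] by (auto split: if_splits)
      then show ?thesis using m d[OF xyz(1,3)] by simp
    next
      assume "\<exists>m::nat. ?m = exp (- real m)"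
      then obtain m :: nat where m: "?m = exp (- real m)" by blast
      then have "d x y \<le> exp (- real m)" "d y z \<le> exp (- real m)" by linarith+
      then show ?thesis using xyz m by (simp add: le_iff)
    qed
    then show "d x z \<le> d x y + d y z" using nonneg[of x y] nonneg[of y z] by linarith
  qed (use nonneg commute in auto)
  interpret Metric_space X d by (rule M)
  have "openin mtopology U \<longleftrightarrow> openin cylinder_topology U" for U
    unfolding openin_cylinder_topology openin_mtopology cylinder_open_def
  proof (intro conj_cong refl, intro iffI allI ballI impI)
    fix x assume U: "U \<subseteq> X" "\<forall>x. x \<in> U \<longrightarrow> (\<exists>r>0. mball x r \<subseteq> U)" and x: "x \<in> U"
    then obtain e where e: "e > 0" "mball x e \<subseteq> U" by blast
    obtain n :: nat where n: "- ln e < real n" using reals_Archimedean2 by blast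
    then have "exp (- real n) < e" using e(1) by (metis exp_less_cancel_iff exp_ln minus_less_iff)
    moreover have "d x y \<le> exp (- real n)" if "y \<in> cylinder x n" for y
      using that U x by (auto simp: le_iff cylinder_def)
    ultimately have "cylinder x n \<subseteq> mball x e"
      using U x by (force simp: cylinder_def)
    then show "\<exists>r. cylinder x r \<subseteq> U" using e by blast
  next
    fix x assume U: "U \<subseteq> X" "\<forall>x\<in>U. \<exists>r. cylinder x r \<subseteq> U" and x: "x \<in> U"
    then obtain r where r: "cylinder x r \<subseteq> U" by blast
    have "mball x (exp (- real r)) \<subseteq> cylinder x r"
    proof
      fix y assume "y \<in> mball x (exp (- real r))"
      then have y: "x \<in> X" "y \<in> X" "d x y \<le> exp (- real r)" by auto
      then have "b x r = b y r" using le_iff by blast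
      then show "y \<in> cylinder x r" using y(2) by (simp add: cylinder_def)
    qed
    then have "mball x (exp (- real r)) \<subseteq> U" using r by blast
    then show "\<exists>r>0. mball x r \<subseteq> U" by (intro exI[of _ "exp (- real r)"]) auto
  qed
  then show "mtopology = cylinder_topology" by (simp add: topology_eq)
qed

text \<open>The cylinders of a fixed radius are open and partition \<open>X\<close>, so a finite
  subcover of \<open>K\<close> leaves finitely many types of that radius.\<close>

lemma finite_types_compact:
  assumes "compactin cylinder_topology K"
  shows "finite ((\<lambda>x. b x r) ` K)"
proof -
  have K: "K \<subseteq> X" using assms by (simp add: compactin_def)
  have cover: "\<forall>U\<in>(\<lambda>x. cylinder x r) ` K. openin cylinder_topology U" "K \<subseteq> \<Union>((\<lambda>x. cylinder x r) ` K)"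
    using K by (auto simp: openin_cylinder) (auto simp: cylinder_def)
  then obtain \<F> where F: "finite \<F>" "\<F> \<subseteq> (\<lambda>x. cylinder x r) ` K" "K \<subseteq> \<Union>\<F>"
    using assms unfolding compactin_def by meson
  then obtain A where A: "finite A" "A \<subseteq> K" "\<F> = (\<lambda>x. cylinder x r) ` A"
    by (meson finite_subset_image)
  then have "(\<lambda>x. b x r) ` K \<subseteq> (\<lambda>x. b x r) ` A" using F(3) by (auto simp: cylinder_def)
  then show ?thesis using A(1) finite_subset by blast
qed

end

text \<open>\<open>complete\<close> says that every ray of the tree of types comes from a point of
  \<open>X\<close>. The ray is given by representatives \<open>z r\<close>, of which only the type
  at radius \<open>r\<close> counts. The function \<open>sz\<close> stands for the number of
  vertices of a ball.\<close>

locale complete_ball_system = ball_system X b lev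
  for X :: "'x set" and b :: "'x \<Rightarrow> nat \<Rightarrow> 't" and lev :: "'t \<Rightarrow> nat" +
  fixes sz :: "'t \<Rightarrow> nat"
  assumes complete: "(\<And>r. z r \<in> X) \<Longrightarrow> (\<And>r. b (z (Suc r)) r = b (z r) r) \<Longrightarrow>
      \<exists>x\<in>X. \<forall>r. b x r = b (z r) r"
    and finite_sz: "finite {t \<in> types. lev t = r \<and> sz t \<le> k}"
begin

section \<open>Compactness, sigma-compactness and branching\<close>

lemma countable_types: "countable types"
proof -
  have "types = (\<Union>r k. {t \<in> types. lev t = r \<and> sz t \<le> k})" by auto
  moreover have "countable (\<Union>r k. {t \<in> types. lev t = r \<and> sz t \<le> k})"
    by (rule countable_UN[OF countableI_type], rule countable_UN[OF countableI_type],
        rule countable_finite[OF finite_sz])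
  ultimately show ?thesis by simp
qed

text \<open>Koenig's argument: a set that no finite subfamily covers contains, level by level, cylinders
  that no finite subfamily covers, and these shrink to a point.\<close>

lemma compact_criterion:
  assumes K: "K \<subseteq> X" and fin: "\<And>r. finite ((\<lambda>x. b x r) ` K)"
    and closed: "\<And>x. x \<in> X \<Longrightarrow> (\<And>r. \<exists>y\<in>K. b y r = b x r) \<Longrightarrow> x \<in> K"
  shows "compactin cylinder_topology K"
  unfolding compactin_def
proof (intro conjI allI impI)
  show "K \<subseteq> topspace cylinder_topology" using K by simp
  fix \<U> assume \<U>: "(\<forall>U\<in>\<U>. openin cylinder_topology U) \<and> K \<subseteq> \<Union>\<U>"
  define fc where "fc A \<longleftrightarrow> (\<exists>\<F>. finite \<F> \<and> \<F> \<subseteq> \<U> \<and> A \<subseteq> \<Union>\<F>)" for A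
  have fc_Union: "fc (\<Union>\<A>)" if "finite \<A>" "\<And>A. A \<in> \<A> \<Longrightarrow> fc A" for \<A>
    using that
  proof (induction \<A>)
    case empty
    then show ?case by (auto simp: fc_def)
  next
    case (insert A \<A>)
    then have "fc A" "fc (\<Union>\<A>)" by auto
    then obtain \<F> \<F>' where F: "finite \<F>" "\<F> \<subseteq> \<U>" "A \<subseteq> \<Union>\<F>"
        and F': "finite \<F>'" "\<F>' \<subseteq> \<U>" "\<Union>\<A> \<subseteq> \<Union>\<F>'"
      unfolding fc_def by (elim exE conjE)
    have "\<Union>(insert A \<A>) \<subseteq> \<Union>(\<F> \<union> \<F>')" using F(3) F'(3) by auto
    moreover have "finite (\<F> \<union> \<F>')" "\<F> \<union> \<F>' \<subseteq> \<U>" using F F' by auto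
    ultimately show ?case unfolding fc_def by (intro exI conjI)
  qed
  have split: "\<exists>x\<in>A. \<not> fc {y \<in> A. b y r = b x r}" if A: "A \<subseteq> K" "\<not> fc A" for A r
  proof (rule ccontr)
    assume *: "\<not> ?thesis"
    have "fc (\<Union>((\<lambda>t. {y \<in> A. b y r = t}) ` (\<lambda>x. b x r) ` A))"
    proof (rule fc_Union)
      show "finite ((\<lambda>t. {y \<in> A. b y r = t}) ` (\<lambda>x. b x r) ` A)"
        using fin[of r] A(1) by (meson finite_imageI finite_subset image_mono)
    qed (use * in auto)
    moreover have "A \<subseteq> \<Union>((\<lambda>t. {y \<in> A. b y r = t}) ` (\<lambda>x. b x r) ` A)" by auto
    ultimately show False using A(2) unfolding fc_def by (meson order_trans)
  qed
  show "\<exists>\<F>. finite \<F> \<and> \<F> \<subseteq> \<U> \<and> K \<subseteq> \<Union>\<F>"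
  proof (rule ccontr)
    assume "\<not> ?thesis"
    then have nK: "\<not> fc K" by (simp add: fc_def)
    have "\<exists>z. \<forall>r. (z r \<in> K \<and> \<not> fc {y \<in> K. b y r = b (z r) r}) \<and> b (z (Suc r)) r = b (z r) r"
    proof (rule dependent_nat_choice)
      show "\<exists>x. x \<in> K \<and> \<not> fc {y \<in> K. b y 0 = b x 0}" using split[OF order_refl nK] by blast
    next
      fix x r assume x: "x \<in> K \<and> \<not> fc {y \<in> K. b y r = b x r}"
      let ?A = "{y \<in> K. b y r = b x r}"
      obtain x' where x': "x' \<in> ?A" "\<not> fc {y \<in> ?A. b y (Suc r) = b x' (Suc r)}"
        using split[of ?A "Suc r"] x by blast
      \<comment> \<open>The type at radius \<open>Suc r\<close> determines the one at radius
        \<open>r\<close>, so the refined piece is again \<open>K\<close> cut by a single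
        cylinder.\<close>
      have "{y \<in> ?A. b y (Suc r) = b x' (Suc r)} = {y \<in> K. b y (Suc r) = b x' (Suc r)}"
        using x'(1) K coherent by (smt (verit, best) Collect_cong mem_Collect_eq subsetD)
      then show "\<exists>y. (y \<in> K \<and> \<not> fc {ya \<in> K. b ya (Suc r) = b y (Suc r)}) \<and> b y r = b x r"
        using x' by auto
    qed
    then obtain z where z: "\<And>r. z r \<in> K" "\<And>r. \<not> fc {y \<in> K. b y r = b (z r) r}"
        "\<And>r. b (z (Suc r)) r = b (z r) r" by blast
    then obtain x where x: "x \<in> X" "\<And>r. b x r = b (z r) r"
      using complete[of z] K by blast
    \<comment> \<open>Completeness places the limit only in \<open>X\<close>; the point
      \<open>z r\<close> of \<open>K\<close> is the witness that \<open>closed\<close> asks for at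
      radius \<open>r\<close>.\<close>
    then have "x \<in> K" using closed z(1) by metis
    then obtain U where U: "U \<in> \<U>" "x \<in> U" using \<U> by blast
    then obtain r where "cylinder x r \<subseteq> U"
      using \<U> unfolding openin_cylinder_topology cylinder_open_def by blast
    then have "{y \<in> K. b y r = b (z r) r} \<subseteq> U" using x K by (auto simp: cylinder_def)
    then have "fc {y \<in> K. b y r = b (z r) r}"
      unfolding fc_def using U by (intro exI[of _ "{U}"]) auto
    then show False using z(2) by blast
  qed
qed

lemma sigma_compact_iff_bounded:
  "sigma_compact_space cylinder_topology \<longleftrightarrow>
     (\<exists>N::nat \<Rightarrow> nat \<Rightarrow> nat. \<forall>x\<in>X. \<exists>n. \<forall>r. sz (b x r) \<le> N n r)"
proof
  assume "sigma_compact_space cylinder_topology"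
  then obtain \<K> where K: "countable \<K>" "\<And>K. K \<in> \<K> \<Longrightarrow> compactin cylinder_topology K" "X \<subseteq> \<Union>\<K>"
    by (auto simp: sigma_compact_space_def)
  \<comment> \<open>The maximum exists since a compact set has finitely many types, hence finitely
    many sizes, at each radius. For an empty family \<open>from_nat_into\<close> is arbitrary, but
    then \<open>X\<close> is empty as well.\<close>
  define N where "N n r = Max ((\<lambda>x. sz (b x r)) ` from_nat_into \<K> n)" for n r
  have "\<exists>n. \<forall>r. sz (b x r) \<le> N n r" if x: "x \<in> X" for x
  proof -
    obtain C where C: "C \<in> \<K>" "x \<in> C" using K(3) x by blast
    then obtain n where n: "from_nat_into \<K> n = C" using from_nat_into_surj[OF K(1) C(1)] by blast
    have "finite ((\<lambda>x. sz (b x r)) ` C)" for r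
      using finite_imageI[OF finite_types_compact[OF K(2)[OF C(1)], of r], of sz]
      by (simp add: image_image)
    then have "sz (b x r) \<le> N n r" for r unfolding N_def n using C(2) by auto
    then show ?thesis by blast
  qed
  then show "\<exists>N::nat \<Rightarrow> nat \<Rightarrow> nat. \<forall>x\<in>X. \<exists>n. \<forall>r. sz (b x r) \<le> N n r" by blast
next
  assume "\<exists>N::nat \<Rightarrow> nat \<Rightarrow> nat. \<forall>x\<in>X. \<exists>n. \<forall>r. sz (b x r) \<le> N n r"
  then obtain N :: "nat \<Rightarrow> nat \<Rightarrow> nat" where N: "\<And>x. x \<in> X \<Longrightarrow> \<exists>n. \<forall>r. sz (b x r) \<le> N n r" by blast
  define K where "K n = {x \<in> X. \<forall>r. sz (b x r) \<le> N n r}" for n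
  have "compactin cylinder_topology (K n)" for n
  proof (rule compact_criterion)
    show "finite ((\<lambda>x. b x r) ` K n)" for r
      by (rule finite_subset[OF _ finite_sz[of r "N n r"]]) (auto simp: K_def types_def lev)
    fix x assume x: "x \<in> X" "\<And>r. \<exists>y\<in>K n. b y r = b x r"
    \<comment> \<open>The bound at radius \<open>r\<close> concerns the type at radius
      \<open>r\<close> alone, which \<open>x\<close> shares with some member of
      \<open>K n\<close>.\<close>
    have "sz (b x r) \<le> N n r" for r
    proof -
      obtain y where y: "y \<in> K n" "b y r = b x r" using x(2) by blast
      then have "\<forall>r. sz (b y r) \<le> N n r" by (simp add: K_def)
      then show ?thesis unfolding y(2)[symmetric] ..
    qed
    then show "x \<in> K n" using x(1) by (simp add: K_def)
  qed (auto simp: K_def)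
  moreover have "X \<subseteq> \<Union>(range K)" using N by (auto simp: K_def)
  ultimately show "sigma_compact_space cylinder_topology"
    unfolding sigma_compact_space_def by (intro exI[of _ "range K"]) auto
qed

text \<open>Diagonalisation: a compact set meets only finitely many children of a branch vertex, so the
  \<open>n\<close>-th step towards a limit point can leave the \<open>n\<close>-th compact set.\<close>

lemma branching_imp_not_sigma_compact:
  assumes U: "branching U"
  shows "\<not> sigma_compact_space cylinder_topology"
proof
  assume "sigma_compact_space cylinder_topology"
  then obtain \<K> where \<K>: "countable \<K>" "\<And>K. K \<in> \<K> \<Longrightarrow> compactin cylinder_topology K" "X \<subseteq> \<Union>\<K>"
    by (auto simp: sigma_compact_space_def)
  obtain u where "u \<in> U" "u \<in> types" using U by (auto simp: branching_def)
  then obtain x0 l0 where x0: "x0 \<in> X" "b x0 l0 \<in> U" by (auto simp: types_def)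
  have "\<K> \<noteq> {}" using \<K>(3) x0 by auto
  define K where "K = from_nat_into \<K>"
  have K: "compactin cylinder_topology (K n)" for n
    using \<K>(2) \<open>\<K> \<noteq> {}\<close> by (simp add: K_def from_nat_into)
  have cover: "\<exists>n. x \<in> K n" if x: "x \<in> X" for x
  proof -
    obtain C where "C \<in> \<K>" "x \<in> C" using \<K>(3) x by auto
    then show ?thesis using from_nat_into_surj[OF \<K>(1), of C] unfolding K_def by metis
  qed
  \<comment> \<open>A pair \<open>(x, l)\<close> stands for the branch vertex \<open>b x l\<close>.
    Each step moves to a branch vertex further up, through a child of the old one that no point of
    \<open>K n\<close> passes.\<close>
  have "\<exists>p. \<forall>n. (fst (p n) \<in> X \<and> b (fst (p n)) (snd (p n)) \<in> U) \<and>
      (snd (p n) < snd (p (Suc n)) \<and> b (fst (p (Suc n))) (snd (p n)) = b (fst (p n)) (snd (p n)) \<and>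
       b (fst (p (Suc n))) (Suc (snd (p n))) \<notin> (\<lambda>y. b y (Suc (snd (p n)))) ` K n)"
  proof (rule dependent_nat_choice)
    show "\<exists>p. fst p \<in> X \<and> b (fst p) (snd p) \<in> U" using x0 by (intro exI[of _ "(x0, l0)"]) simp
  next
    fix p n assume "fst p \<in> X \<and> b (fst p) (snd p) \<in> U"
    then obtain x l where p: "p = (x, l)" "x \<in> X" "b x l \<in> U" by (cases p) auto
    let ?C = "{b y (Suc l) | y. y \<in> X \<and> b y l = b x l \<and> (\<exists>s>l. b y s \<in> U)}"
    have "infinite ?C" using U p(2,3) by (auto simp: branching_def lev)
    then have "\<not> ?C \<subseteq> (\<lambda>y. b y (Suc l)) ` K n"
      using finite_types_compact[OF K] finite_subset by blast
    then obtain y s where "y \<in> X" "b y l = b x l" "s > l" "b y s \<in> U"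
      "b y (Suc l) \<notin> (\<lambda>y. b y (Suc l)) ` K n" by blast
    then show "\<exists>q. (fst q \<in> X \<and> b (fst q) (snd q) \<in> U) \<and>
      (snd p < snd q \<and> b (fst q) (snd p) = b (fst p) (snd p) \<and>
       b (fst q) (Suc (snd p)) \<notin> (\<lambda>y. b y (Suc (snd p))) ` K n)"
      using p(1) by (intro exI[of _ "(y, s)"]) auto
  qed
  then obtain p where p: "\<And>n. fst (p n) \<in> X" "\<And>n. snd (p n) < snd (p (Suc n))"
      "\<And>n. b (fst (p (Suc n))) (snd (p n)) = b (fst (p n)) (snd (p n))"
      "\<And>n. b (fst (p (Suc n))) (Suc (snd (p n))) \<notin> (\<lambda>y. b y (Suc (snd (p n)))) ` K n" by blast
  define z where "z = fst \<circ> p"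
  define l where "l = snd \<circ> p"
  have z: "z n \<in> X" "l n < l (Suc n)" "b (z (Suc n)) (l n) = b (z n) (l n)"
      "b (z (Suc n)) (Suc (l n)) \<notin> (\<lambda>y. b y (Suc (l n))) ` K n" for n
    using p by (auto simp: z_def l_def)
  have mono: "strict_mono l" using z(2) by (simp add: strict_mono_Suc_iff)
  have stable: "b (z m) (l n) = b (z n) (l n)" if "n \<le> m" for n m
    using that
  proof (induction rule: dec_induct)
    case (step m)
    have "b (z (Suc m)) (l n) = b (z m) (l n)"
      using coherent_le[OF z(1) z(1) z(3)] mono step(1) by (simp add: strict_mono_less_eq)
    then show ?case using step by simp
  qed simp
  \<comment> \<open>The radii \<open>l\<close> increase strictly, hence \<open>r \<le> l r\<close>,
    and agreement of consecutive points at \<open>l r\<close> descends to \<open>r\<close>.\<close>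
  have "\<exists>x\<in>X. \<forall>r. b x r = b (z r) r"
  proof (rule complete)
    show "b (z (Suc r)) r = b (z r) r" for r
      using coherent_le[OF z(1) z(1) z(3)] strict_mono_imp_increasing[OF mono] by blast
  qed (rule z)
  then obtain x where x: "x \<in> X" "\<And>r. b x r = b (z r) r" by blast
  obtain n where n: "x \<in> K n" using cover x(1) by blast
  \<comment> \<open>The type of \<open>x\<close> at radius \<open>Suc (l n)\<close> is that of
    \<open>z (Suc (l n))\<close>. As \<open>n \<le> l n\<close>, it agrees with that of
    \<open>z (Suc n)\<close>, which was chosen to avoid \<open>K n\<close>.\<close>
  have "b (z (Suc (l n))) (l (Suc n)) = b (z (Suc n)) (l (Suc n))"
    by (rule stable) (simp add: strict_mono_imp_increasing[OF mono])
  then have "b (z (Suc (l n))) (Suc (l n)) = b (z (Suc n)) (Suc (l n))"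
    by (rule coherent_le[OF z(1) z(1)]) (simp add: Suc_leI z(2))
  then have "b (z (Suc n)) (Suc (l n)) = b x (Suc (l n))" using x(2) by simp
  then show False using z(4)[of n] n by (metis imageI)
qed

text \<open>A type is \<open>small\<close> if its cylinder is sigma-compact. If above a type that is not small no
  type had infinitely many children that are not small, then its cylinder would consist of countably
  many small cylinders and of the compact set of points through types that are not small.\<close>

lemma not_sigma_compact_imp_branching:
  assumes "\<not> sigma_compact_space cylinder_topology"
  shows "\<exists>U. branching U"
proof -
  define small where "small t \<longleftrightarrow> (\<exists>\<K>. countable \<K> \<and> (\<forall>K\<in>\<K>. compactin cylinder_topology K) \<and>
    {x \<in> X. b x (lev t) = t} \<subseteq> \<Union>\<K>)" for t
  define children where
    "children t = {b x (Suc (lev t)) | x. x \<in> X \<and> b x (lev t) = t \<and> \<not> small (b x (Suc (lev t)))}" for t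
  define U where "U = {t \<in> types. \<not> small t \<and> infinite (children t)}"
  have reach_U: "\<exists>x\<in>X. b x (lev t) = t \<and> (\<exists>s\<ge>lev t. b x s \<in> U)"
    if t: "t \<in> types" "\<not> small t" for t
  proof (rule ccontr)
    assume neg: "\<not> ?thesis"
    define C where "C = {x \<in> X. b x (lev t) = t \<and> (\<forall>s\<ge>lev t. \<not> small (b x s))}"
    \<comment> \<open>The types of a point of \<open>C\<close> from \<open>t\<close> on are not
      small; infinitely many such children would put one of them into \<open>U\<close>, against
      \<open>neg\<close>.\<close>
    have fin_children: "finite (children (b x s))" if "x \<in> C" "s \<ge> lev t" for x s
      using that neg unfolding C_def U_def types_def by blast
    have "finite ((\<lambda>x. b x (lev t + k)) ` C)" for k
    proof (induction k)
      case 0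
      have "(\<lambda>x. b x (lev t + 0)) ` C \<subseteq> {t}" by (auto simp: C_def)
      then show ?case using finite_subset by blast
    next
      case (Suc k)
      have "(\<lambda>x. b x (lev t + Suc k)) ` C \<subseteq> (\<Union>s\<in>(\<lambda>x. b x (lev t + k)) ` C. children s)"
      proof safe
        fix x assume x: "x \<in> C"
        then have "b x (lev t + Suc k) \<in> children (b x (lev t + k))"
          unfolding children_def by (intro CollectI exI[of _ x]) (auto simp: C_def lev)
        then show "b x (lev t + Suc k) \<in> (\<Union>s\<in>(\<lambda>x. b x (lev t + k)) ` C. children s)"
          using x by blast
      qed
      moreover have "finite \<dots>" using Suc by (rule finite_UN_I) (auto intro: fin_children)
      ultimately show ?case using finite_subset by blast
    qed
    note fin_C = this
    have "compactin cylinder_topology C"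
    proof (rule compact_criterion)
      show "C \<subseteq> X" by (auto simp: C_def)
      show "finite ((\<lambda>x. b x r) ` C)" for r
      proof (cases "r \<le> lev t")
        case True
        have eq: "b x r = b y r" if "x \<in> C" "y \<in> C" for x y
          using that True coherent_le[of x y "lev t" r] by (simp add: C_def)
        show ?thesis
        proof (cases "C = {}")
          case False
          then obtain y where "y \<in> C" by blast
          then have "(\<lambda>x. b x r) ` C \<subseteq> {b y r}" using eq by blast
          then show ?thesis by (rule finite_subset) simp
        qed simp
      next
        case False
        then show ?thesis using fin_C[of "r - lev t"] by simp
      qed
      fix x assume x: "x \<in> X" "\<And>r. \<exists>y\<in>C. b y r = b x r"
      have "b x (lev t) = t" using x(2)[of "lev t"] by (auto simp: C_def)
      moreover have "\<not> small (b x s)" if "s \<ge> lev t" for s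
        using x(2)[of s] that by (auto simp: C_def)
      ultimately show "x \<in> C" using x(1) by (simp add: C_def)
    qed
    have "\<forall>s\<in>Collect small. \<exists>\<K>. countable \<K> \<and> (\<forall>K\<in>\<K>. compactin cylinder_topology K) \<and>
        {x \<in> X. b x (lev s) = s} \<subseteq> \<Union>\<K>" by (simp add: small_def)
    from bchoice[OF this] obtain \<K> where \<K>: "\<forall>s\<in>Collect small. countable (\<K> s) \<and>
        (\<forall>K\<in>\<K> s. compactin cylinder_topology K) \<and> {x \<in> X. b x (lev s) = s} \<subseteq> \<Union>(\<K> s)" ..
    moreover have "{x \<in> X. b x (lev t) = t} \<subseteq> \<Union>(insert C (\<Union>s\<in>{s \<in> types. small s}. \<K> s))"
    proof
      fix x assume x: "x \<in> {x \<in> X. b x (lev t) = t}"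
      show "x \<in> \<Union>(insert C (\<Union>s\<in>{s \<in> types. small s}. \<K> s))"
      proof (cases "x \<in> C")
        case False
        then obtain s where s: "small (b x s)" using x by (auto simp: C_def)
        then have "{y \<in> X. b y (lev (b x s)) = b x s} \<subseteq> \<Union>(\<K> (b x s))" using \<K> by blast
        then have "x \<in> \<Union>(\<K> (b x s))" using x by (auto simp: lev)
        moreover have "b x s \<in> types" using x by (auto simp: types_def)
        ultimately show ?thesis using s by blast
      qed simp
    qed
    moreover have "countable (insert C (\<Union>s\<in>{s \<in> types. small s}. \<K> s))"
    proof -
      \<comment> \<open>Countability of the tree is what allows all small cylinders to be collected
        at once.\<close>
      have "countable {s \<in> types. small s}" by (rule countable_subset[OF _ countable_types]) auto
      then show ?thesis using \<K> by (intro countable_insert countable_UN) auto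
    qed
    moreover have "\<forall>K\<in>insert C (\<Union>s\<in>{s \<in> types. small s}. \<K> s). compactin cylinder_topology K"
      using \<open>compactin cylinder_topology C\<close> \<K> by auto
    ultimately have "small t" unfolding small_def by blast
    then show False using t by simp
  qed
  have "branching U"
    unfolding branching_def
  proof (intro conjI ballI)
    show "U \<subseteq> types" by (auto simp: U_def)
    have "X \<noteq> {}" using assms by (auto simp: sigma_compact_space_def intro: exI[of _ "{}"])
    then obtain x where x: "x \<in> X" by blast
    \<comment> \<open>The cylinder of the type at radius 0 is the whole space, so this type is not
      small and serves as a starting point.\<close>
    then have "{y \<in> X. b y (lev (b x 0)) = b x 0} = X" unfolding lev[OF x] using root by blast
    then have "\<not> small (b x 0)" using assms by (simp add: small_def sigma_compact_space_def)
    then show "U \<noteq> {}" using reach_U[of "b x 0"] x by (auto simp: types_def)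
    fix u assume u: "u \<in> U"
    \<comment> \<open>Each child of \<open>u\<close> that is not small has a member of
      \<open>U\<close> at or above it, and \<open>u\<close> has infinitely many of these
      children.\<close>
    have "children u \<subseteq> {b x (Suc (lev u)) | x. x \<in> X \<and> b x (lev u) = u \<and> (\<exists>s>lev u. b x s \<in> U)}"
    proof
      fix c assume "c \<in> children u"
      then obtain x where x: "c = b x (Suc (lev u))" "x \<in> X" "b x (lev u) = u" "\<not> small c"
        by (auto simp: children_def)
      then have "c \<in> types" "lev c = Suc (lev u)" by (auto simp: types_def lev)
      then obtain y s where y: "y \<in> X" "b y (Suc (lev u)) = c" "s \<ge> Suc (lev u)" "b y s \<in> U"
        using reach_U[of c] x(4) by auto
      then have "b y (lev u) = u" using coherent[of y x "lev u"] x by simp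
      then show "c \<in> {b x (Suc (lev u)) | x. x \<in> X \<and> b x (lev u) = u \<and> (\<exists>s>lev u. b x s \<in> U)}"
        using y by (auto intro!: exI[of _ y] exI[of _ s])
    qed
    moreover have "infinite (children u)" using u by (simp add: U_def)
    ultimately show "infinite {b x (Suc (lev u)) | x. x \<in> X \<and> b x (lev u) = u \<and> (\<exists>s>lev u. b x s \<in> U)}"
      using finite_subset by blast
  qed
  then show ?thesis by blast
qed

end

section \<open>Subdivisions in the tree of ball types\<close>

lemma walk_rev:
  assumes "walk G p"
  shows "walk G (rev p)"
  using assms by (simp add: walk_def insert_commute)

lemma walk_subgraph: "subgraph S G \<Longrightarrow> walk S p \<Longrightarrow> walk G p"
  unfolding walk_def subgraph_def by (auto intro: successively_mono)

text \<open>Naming an edge by its longer end identifies the edges of \<open>T_inf\<close> with the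
  nonempty sequences; the paths of a subdivision can then be indexed by sequences.\<close>

lemma T_inf_edges: "edges T_inf = {{tl ys, ys} | ys. ys \<noteq> []}"
proof -
  have "(\<exists>n xs. e = {xs, n # xs}) \<longleftrightarrow> (\<exists>ys. e = {tl ys, ys} \<and> ys \<noteq> [])" for e :: "nat list set"
    by (metis list.collapse list.sel(3) list.distinct(1))
  then show ?thesis by (simp add: T_inf_def)
qed

lemma T_inf_edge_unique:
  assumes "ys \<noteq> []" "zs \<noteq> []" "{tl ys, ys} = {tl zs, zs}"
  shows "ys = zs"
proof (rule ccontr)
  assume "ys \<noteq> zs"
  then have "tl ys = zs" "ys = tl zs" using assms(3) by (auto simp: doubleton_eq_iff)
  then have "length ys - 1 = length zs" "length ys = length zs - 1" by (metis length_tl)+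
  then show False using assms(1,2) by (cases ys; cases zs) auto
qed

context ball_system
begin

definition type_tree :: "'t ugraph" where
  "type_tree = \<lparr>verts = types, edges = {{b x r, b x (Suc r)} | x r. x \<in> X}\<rparr>"

lemma type_tree_edgeD:
  assumes "{s, t} \<in> edges type_tree"
  obtains x where "x \<in> X" "s = b x (lev s)" "t = b x (lev t)" "lev t = Suc (lev s) \<or> lev s = Suc (lev t)"
proof -
  obtain x r where x: "x \<in> X" "{s, t} = {b x r, b x (Suc r)}" using assms by (auto simp: type_tree_def)
  then have "s = b x r \<and> t = b x (Suc r) \<or> t = b x r \<and> s = b x (Suc r)"
    by (auto simp: doubleton_eq_iff)
  then show thesis using that[of x] x(1) lev[OF x(1)] by auto
qed

text \<open>Every type has only one parent, so a path that starts upwards never turns back.\<close>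

lemma ascending_path:
  assumes q: "walk type_tree q" "distinct q" "lev (q ! 1) = Suc (lev (q ! 0))" and i: "i < length q"
  shows "\<exists>x\<in>X. \<forall>j\<le>i. q ! j = b x (lev (q ! 0) + j)"
  using i
proof (induction i)
  case 0
  then have "q ! 0 \<in> types" using q(1) by (auto simp: walk_def type_tree_def)
  then show ?case using lev by (auto simp: types_def)
next
  case (Suc i)
  let ?l = "lev (q ! 0)"
  obtain x where x: "x \<in> X" "\<And>j. j \<le> i \<Longrightarrow> q ! j = b x (?l + j)" using Suc by auto
  obtain y where y: "y \<in> X" "q ! i = b y (lev (q ! i))" "q ! Suc i = b y (lev (q ! Suc i))"
      "lev (q ! Suc i) = Suc (lev (q ! i)) \<or> lev (q ! i) = Suc (lev (q ! Suc i))"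
    using type_tree_edgeD[OF walk_nth[OF q(1) Suc.prems]] by blast
  have li: "lev (q ! i) = ?l + i" using x(2)[of i] lev[OF x(1)] by simp
  have yx: "b y (?l + j) = b x (?l + j)" if "j \<le> i" for j
    using coherent_le[OF y(1) x(1), of "?l + i" "?l + j"] y(2) x(2)[of i] li that by simp
  have up: "lev (q ! Suc i) = Suc (lev (q ! i))"
  proof (rule ccontr)
    assume "\<not> ?thesis"
    then have down: "?l + i = Suc (lev (q ! Suc i))" using y(4) li by simp
    then have "i \<noteq> 0" using q(3) by (cases i) auto
    then obtain k where k: "i = Suc k" by (cases i) auto
    then have "lev (q ! Suc i) = ?l + k" using down by simp
    then have "q ! Suc i = q ! k" using y(3) yx[of k] x(2)[of k] k by simp
    then show False using q(2) Suc.prems k by (simp add: nth_eq_iff_index_eq)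
  qed
  \<comment> \<open>The witness changes from \<open>x\<close> to \<open>y\<close>: it passes through
    the new vertex and, by coherence, through everything that \<open>x\<close> passed up to
    \<open>q ! i\<close>.\<close>
  have "q ! j = b y (?l + j)" if "j \<le> Suc i" for j
  proof (cases "j = Suc i")
    case True
    then show ?thesis using y(3) up li by simp
  next
    case False
    then have "j \<le> i" using that by simp
    then show ?thesis using x(2)[of j] yx[of j] by (rule_tac trans[OF _ sym])
  qed
  then show ?case using y(1) by blast
qed

text \<open>Take the branch vertices of the subdivision as \<open>U\<close>. From each of them
  infinitely many paths leave through different neighbours. Only one neighbour is the parent, so all
  of these paths but at most one start upwards; they never turn back and end in a branch vertex
  above the child they started with.\<close>

lemma subdivision_imp_branching:
  assumes "contains_subdivision type_tree T_inf"
  shows "\<exists>U. branching U"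
proof -
  obtain S where S: "subgraph S type_tree" "is_subdivision S T_inf"
    using assms by (auto simp: contains_subdivision_def)
  have vT: "verts T_inf = UNIV" by (simp add: T_inf_def)
  obtain \<phi> P where \<phi>: "inj \<phi>"
    and P: "\<forall>e\<in>edges T_inf. simple_path S (P e) \<and> {hd (P e), last (P e)} = \<phi> ` e \<and>
           interior_verts (P e) \<inter> range \<phi> = {}"
    and disj: "\<forall>e\<in>edges T_inf. \<forall>e'\<in>edges T_inf. e \<noteq> e' \<longrightarrow>
           interior_verts (P e) \<inter> interior_verts (P e') = {}"
    and vS: "verts S = range \<phi> \<union> (\<Union>e\<in>edges T_inf. set (P e))"
    using S(2) unfolding is_subdivision_def vT by (elim exE conjE) (rule that; assumption)
  note P = bspec[OF P]
  have types: "range \<phi> \<subseteq> types" using S(1) vS by (auto simp: subgraph_def type_tree_def)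
  have edge: "{xs, n # xs} \<in> edges T_inf" for xs n by (auto simp: T_inf_def)
  \<comment> \<open>The path of an edge may run either way and is reversed where necessary, so that
    it starts at \<open>\<phi> xs\<close>.\<close>
  have "\<exists>q. walk type_tree q \<and> distinct q \<and> hd q = \<phi> xs \<and> last q = \<phi> (n # xs) \<and>
      set (butlast (tl q)) = interior_verts (P {xs, n # xs})" for xs n
  proof -
    let ?p = "P {xs, n # xs}"
    have p: "walk type_tree ?p" "distinct ?p" "{hd ?p, last ?p} = {\<phi> xs, \<phi> (n # xs)}"
      using P[OF edge[of xs n]] walk_subgraph[OF S(1)] by (auto simp: simple_path_def)
    consider "hd ?p = \<phi> xs" "last ?p = \<phi> (n # xs)" | "last ?p = \<phi> xs" "hd ?p = \<phi> (n # xs)"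
      using p(3) by (auto simp: doubleton_eq_iff)
    then show ?thesis
    proof cases
      case 1
      then show ?thesis using p by (intro exI[of _ ?p]) (simp add: interior_verts_def)
    next
      case 2
      have "butlast (tl (rev ?p)) = rev (butlast (tl ?p))"
        by (metis butlast_rev butlast_tl rev_rev_ident)
      then have "set (butlast (tl (rev ?p))) = interior_verts ?p" by (simp add: interior_verts_def)
      then show ?thesis using p 2 walk_rev[OF p(1)]
        by (intro exI[of _ "rev ?p"]) (simp add: hd_rev last_rev)
    qed
  qed
  then obtain q where q: "\<And>xs n. walk type_tree (q xs n)" "\<And>xs n. distinct (q xs n)"
      "\<And>xs n. hd (q xs n) = \<phi> xs" "\<And>xs n. last (q xs n) = \<phi> (n # xs)"
      "\<And>xs n. set (butlast (tl (q xs n))) = interior_verts (P {xs, n # xs})" by metis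
  have len: "length (q xs n) \<ge> 2" for xs n
  proof -
    have "q xs n \<noteq> []" using q(1) by (auto simp: walk_def)
    moreover have "hd (q xs n) \<noteq> last (q xs n)" using q(3,4) injD[OF \<phi>, of xs "n # xs"] by auto
    ultimately show ?thesis by (cases "q xs n"; cases "tl (q xs n)") auto
  qed
  define c where "c xs n = q xs n ! 1" for xs n
  have c_cases: "c xs n \<in> interior_verts (P {xs, n # xs}) \<or> c xs n = \<phi> (n # xs)" for xs n
    using len[of xs n] unfolding q(5)[symmetric] q(4)[symmetric] c_def
    by (cases "q xs n"; cases "tl (q xs n)") auto
  \<comment> \<open>A second vertex is interior to its path or its far end. Interiors are disjoint
    from each other and from the branch vertices, and far ends are distinct, so different paths
    leave through different neighbours.\<close>
  have inj_c: "inj (c xs)" for xs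
  proof (rule injI, rule ccontr)
    fix n m assume eq: "c xs n = c xs m" and "n \<noteq> m"
    then have "{xs, n # xs} \<noteq> {xs, m # xs}" by (auto simp: doubleton_eq_iff)
    then have "interior_verts (P {xs, n # xs}) \<inter> interior_verts (P {xs, m # xs}) = {}"
      by (rule disj[rule_format, OF edge edge])
    moreover have "\<phi> (n # xs) \<noteq> \<phi> (m # xs)"
      using \<open>n \<noteq> m\<close> injD[OF \<phi>, of "n # xs" "m # xs"] by auto
    ultimately show False
      using c_cases[of xs n] c_cases[of xs m] eq P[OF edge[of xs n]] P[OF edge[of xs m]] by auto
  qed
  have q0: "q xs n ! 0 = \<phi> xs" for xs n
    using q(3)[of xs n] len[of xs n] by (cases "q xs n") auto
  have "branching (range \<phi>)"
    unfolding branching_def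
  proof (intro conjI ballI)
    fix u assume "u \<in> range \<phi>"
    then obtain xs where u: "u = \<phi> xs" by blast
    define good where "good = {n. lev (c xs n) = Suc (lev u)}"
    have parent: "\<exists>y\<in>X. b y (lev u) = u \<and> lev u = Suc (lev (c xs n)) \<and> c xs n = b y (lev (c xs n))"
      if n: "n \<notin> good" for n
    proof -
      have "{u, c xs n} \<in> edges type_tree"
        using walk_nth[OF q(1), of 0 xs n] len[of xs n] by (simp add: q0 u c_def)
      then obtain y where "y \<in> X" "u = b y (lev u)" "c xs n = b y (lev (c xs n))"
          "lev (c xs n) = Suc (lev u) \<or> lev u = Suc (lev (c xs n))"
        by (rule type_tree_edgeD)
      then show ?thesis using n by (auto simp: good_def)
    qed
    have unique_parent: "n = m" if n: "n \<notin> good" and m: "m \<notin> good" for n m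
    proof -
      obtain y where y: "y \<in> X" "b y (lev u) = u" "lev u = Suc (lev (c xs n))" "c xs n = b y (lev (c xs n))"
        using parent[OF n] by blast
      obtain w where w: "w \<in> X" "b w (lev u) = u" "lev u = Suc (lev (c xs m))" "c xs m = b w (lev (c xs m))"
        using parent[OF m] by blast
      have "lev (c xs m) = lev (c xs n)" using y(3) w(3) by simp
      moreover have "b y (lev (c xs n)) = b w (lev (c xs n))"
        by (rule coherent_le[OF y(1) w(1), of "lev u"]) (use y(2,3) w(2) in simp_all)
      ultimately have "c xs n = c xs m" using y(4) w(4) by metis
      then show ?thesis by (rule injD[OF inj_c])
    qed
    then have "finite (- good)"
    proof (cases "- good = {}")
      case False
      then obtain n where "n \<notin> good" by blast
      then have "- good \<subseteq> {n}" using unique_parent by blast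
      then show ?thesis by (rule finite_subset) simp
    qed simp
    then have "infinite good" by (metis finite_compl infinite_UNIV_nat double_complement)
    then have "infinite (c xs ` good)"
      by (subst finite_image_iff) (auto intro: inj_on_subset[OF inj_c])
    moreover have "c xs ` good \<subseteq> {b x (Suc (lev u)) | x. x \<in> X \<and> b x (lev u) = u \<and>
        (\<exists>s>lev u. b x s \<in> range \<phi>)}"
    proof
      fix t assume "t \<in> c xs ` good"
      then obtain n where n: "t = c xs n" "n \<in> good" by blast
      define k where "k = length (q xs n) - 1"
      have "lev (q xs n ! 1) = Suc (lev (q xs n ! 0))" using n(2) by (simp add: good_def c_def q0 u)
      moreover have "k < length (q xs n)" using len[of xs n] by (simp add: k_def)
      ultimately have "\<exists>x\<in>X. \<forall>j\<le>k. q xs n ! j = b x (lev u + j)"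
        using ascending_path[OF q(1) q(2), of xs n k] unfolding q0 u by blast
      then obtain x where x: "x \<in> X" "\<And>j. j \<le> k \<Longrightarrow> q xs n ! j = b x (lev u + j)" by blast
      have "k \<ge> 1" using len[of xs n] by (simp add: k_def)
      moreover have "q xs n ! k = \<phi> (n # xs)"
        unfolding k_def using q(4)[of xs n] len[of xs n] last_conv_nth[of "q xs n"] by force
      ultimately have "b x (lev u + k) = \<phi> (n # xs)" "b x (lev u) = u" "b x (Suc (lev u)) = t"
        using x(2)[of k] x(2)[of 0] x(2)[of 1] unfolding q0 u n(1) c_def by simp_all
      then show "t \<in> {b x (Suc (lev u)) | x. x \<in> X \<and> b x (lev u) = u \<and> (\<exists>s>lev u. b x s \<in> range \<phi>)}"
        using x(1) \<open>k \<ge> 1\<close> by (intro CollectI exI[of _ x] conjI exI[of _ "lev u + k"]) simp_all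
    qed
    ultimately show "infinite {b x (Suc (lev u)) | x. x \<in> X \<and> b x (lev u) = u \<and>
        (\<exists>s>lev u. b x s \<in> range \<phi>)}"
      using finite_subset by blast
  qed (use types in auto)
  then show ?thesis by blast
qed

text \<open>The branch vertex of a finite sequence \<open>xs\<close> will be \<open>b (z xs) (l xs)\<close>.\<close>

lemma branching_imp_tree_embedding:
  assumes "branching U"
  obtains z :: "nat list \<Rightarrow> 'x" and l :: "nat list \<Rightarrow> nat" where
    "\<And>xs. z xs \<in> X" "\<And>n xs. b (z (n # xs)) (l xs) = b (z xs) (l xs)" "\<And>n xs. l xs < l (n # xs)"
    "\<And>xs. inj (\<lambda>n. b (z (n # xs)) (Suc (l xs)))"
proof -
  \<comment> \<open>A sequence of distinct children of \<open>u\<close> is chosen, each with a point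
    through it and a radius at which this point is in \<open>U\<close> again.\<close>
  have "\<exists>f::nat \<Rightarrow> 'x \<times> nat. \<forall>n. fst (f n) \<in> X \<and> b (fst (f n)) (lev u) = u \<and> lev u < snd (f n) \<and>
      b (fst (f n)) (snd (f n)) \<in> U \<and> inj (\<lambda>n. b (fst (f n)) (Suc (lev u)))" if u: "u \<in> U" for u
  proof -
    let ?C = "{b x (Suc (lev u)) | x. x \<in> X \<and> b x (lev u) = u \<and> (\<exists>s>lev u. b x s \<in> U)}"
    have "infinite ?C" using assms u by (auto simp: branching_def)
    then obtain g :: "nat \<Rightarrow> 't" where g: "inj g" "range g \<subseteq> ?C"
      using infinite_countable_subset by blast
    then have "\<exists>p. fst p \<in> X \<and> b (fst p) (lev u) = u \<and> lev u < snd p \<and> b (fst p) (snd p) \<in> U \<and>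
        b (fst p) (Suc (lev u)) = g n" for n
    proof -
      have "g n \<in> ?C" using g(2) by blast
      then obtain x s where "g n = b x (Suc (lev u))" "x \<in> X" "b x (lev u) = u" "s > lev u" "b x s \<in> U"
        by blast
      then show ?thesis by (intro exI[of _ "(x, s)"]) simp
    qed
    then obtain f where f: "\<And>n. fst (f n) \<in> X \<and> b (fst (f n)) (lev u) = u \<and> lev u < snd (f n) \<and>
        b (fst (f n)) (snd (f n)) \<in> U \<and> b (fst (f n)) (Suc (lev u)) = g n" by metis
    then show ?thesis using g(1) by (intro exI[of _ f]) auto
  qed
  then obtain f :: "'t \<Rightarrow> nat \<Rightarrow> 'x \<times> nat" where f: "\<And>u n. u \<in> U \<Longrightarrow> fst (f u n) \<in> X \<and>
      b (fst (f u n)) (lev u) = u \<and> lev u < snd (f u n) \<and> b (fst (f u n)) (snd (f u n)) \<in> U \<and>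
      inj (\<lambda>n. b (fst (f u n)) (Suc (lev u)))" by metis
  obtain u0 where "u0 \<in> U" "u0 \<in> types" using assms by (auto simp: branching_def)
  then obtain x0 l0 where x0: "x0 \<in> X" "b x0 l0 \<in> U" by (auto simp: types_def)
  \<comment> \<open>Sequences grow at the front: the entry \<open>n\<close> selects the
    \<open>n\<close>-th continuation from the branch vertex already assigned to
    \<open>xs\<close>.\<close>
  define \<psi> where "\<psi> = rec_list (x0, l0) (\<lambda>n xs p. f (b (fst p) (snd p)) n)"
  define \<phi> where "\<phi> xs = b (fst (\<psi> xs)) (snd (\<psi> xs))" for xs
  have Cons: "\<psi> (n # xs) = f (\<phi> xs) n" for n xs by (simp add: \<psi>_def \<phi>_def)
  have inU: "fst (\<psi> xs) \<in> X \<and> \<phi> xs \<in> U" for xs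
  proof (induction xs)
    case Nil
    then show ?case using x0 by (simp add: \<phi>_def \<psi>_def)
  next
    case (Cons n xs)
    then show ?case using f[of "\<phi> xs" n] by (simp add: \<phi>_def[of "n # xs"] \<open>\<And>n xs. \<psi> (n # xs) = f (\<phi> xs) n\<close>)
  qed
  have lev_\<phi>: "lev (\<phi> xs) = snd (\<psi> xs)" for xs using inU[of xs] lev by (simp add: \<phi>_def)
  show thesis
  proof (rule that[of "\<lambda>xs. fst (\<psi> xs)" "\<lambda>xs. snd (\<psi> xs)"])
    fix n xs
    note fn = f[of "\<phi> xs", unfolded lev_\<phi>, folded Cons]
    show "fst (\<psi> xs) \<in> X" using inU by blast
    show "b (fst (\<psi> (n # xs))) (snd (\<psi> xs)) = b (fst (\<psi> xs)) (snd (\<psi> xs))"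
      using fn[of n] inU by (simp add: \<phi>_def)
    show "snd (\<psi> xs) < snd (\<psi> (n # xs))" using fn[of n] inU by blast
    show "inj (\<lambda>n. b (fst (\<psi> (n # xs))) (Suc (snd (\<psi> xs))))" using fn[of n] inU by blast
  qed
qed

text \<open>The edge from \<open>tl xs\<close> to \<open>xs\<close> becomes the stretch of types of
  \<open>z xs\<close> between the radii \<open>l (tl xs)\<close> and \<open>l xs\<close>. Each
  vertex thus gets a name \<open>(xs, k)\<close>, and injectivity of \<open>\<phi>\<close> as well
  as all disjointness conditions reduce to the uniqueness of names.\<close>

lemma branching_imp_subdivision:
  assumes "branching U"
  shows "contains_subdivision type_tree T_inf"
proof -
  obtain z :: "nat list \<Rightarrow> 'x" and l :: "nat list \<Rightarrow> nat" where
    z: "\<And>xs. z xs \<in> X" and step: "\<And>n xs. b (z (n # xs)) (l xs) = b (z xs) (l xs)"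
    and l: "\<And>n xs. l xs < l (n # xs)" and inj: "\<And>xs. inj (\<lambda>n. b (z (n # xs)) (Suc (l xs)))"
    using branching_imp_tree_embedding[OF assms] by blast
  define \<phi> where "\<phi> xs = b (z xs) (l xs)" for xs
  have l_mono: "l xs \<le> l (us @ xs)" for us xs
  proof (induction us)
    case (Cons n us)
    then show ?case using l[of "us @ xs" n] by simp
  qed simp
  have anc: "b (z (us @ xs)) j = b (z xs) j" if "j \<le> l xs" for us xs j
  proof (induction us)
    case (Cons n us)
    have "b (z (n # us @ xs)) j = b (z (us @ xs)) j"
      using coherent_le[OF z z step[of n "us @ xs"], of j] l_mono[of xs us] that by simp
    then show ?case using Cons by simp
  qed simp
  \<comment> \<open>The range of \<open>k\<close> is half-open: the upper end of a stretch belongs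
    to \<open>xs\<close>, the lower end to \<open>tl xs\<close>.\<close>
  define valid where "valid xs k \<longleftrightarrow> k \<le> l xs \<and> (xs \<noteq> [] \<longrightarrow> l (tl xs) < k)" for xs k
  have suffix_less: "k < k'" if "valid xs k" "valid ys k'" "strict_suffix xs ys" for xs ys k k'
  proof -
    obtain us where us: "ys = us @ xs" "us \<noteq> []" using \<open>strict_suffix xs ys\<close>
      by (auto simp: strict_suffix_def suffix_def)
    then have "l xs \<le> l (tl ys)" using l_mono[of xs "tl us"] by simp
    then show ?thesis using that us by (auto simp: valid_def)
  qed
  \<comment> \<open>Equal types have equal radii, which excludes by \<open>suffix_less\<close> that
    one sequence extends the other. Otherwise they part above a common suffix \<open>ws\<close>,
    into different children of its branch vertex, and by coherence the types at radius
    \<open>Suc (l ws)\<close> would have to coincide.\<close>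
  have unique: "xs = ys" if v: "valid xs k" "valid ys k'" and eq: "b (z xs) k = b (z ys) k'" for xs ys k k'
  proof (rule ccontr)
    assume ne: "xs \<noteq> ys"
    have k: "k = k'" using eq lev z by metis
    have "\<not> strict_suffix xs ys" "\<not> strict_suffix ys xs"
      using suffix_less[OF v] suffix_less[OF v(2,1)] k by auto
    \<comment> \<open>Reversal turns suffixes into prefixes, for which the decomposition at the
      first difference is available.\<close>
    then have "rev xs \<parallel> rev ys" using ne
      by (auto simp: parallel_def suffix_to_prefix[symmetric] strict_suffix_def)
    then obtain as n us m vs where d: "n \<noteq> m" "rev xs = as @ n # us" "rev ys = as @ m # vs"
      using parallel_decomp by blast
    define ws where "ws = rev as"
    have xs: "xs = rev us @ n # ws" and ys: "ys = rev vs @ m # ws"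
      using d(2,3) by (simp_all add: rev_swap ws_def)
    have "l ws < k"
    proof (cases "rev us")
      case Nil
      then show ?thesis using v(1) xs by (simp add: valid_def)
    next
      case (Cons a as')
      then have "l (n # ws) \<le> l (tl xs)" using l_mono[of "n # ws" as'] xs by simp
      then show ?thesis using v(1) xs l[of ws n] by (simp add: valid_def)
    qed
    then have "b (z xs) (Suc (l ws)) = b (z ys) (Suc (l ws))"
      using coherent_le[of "z xs" "z ys" k "Suc (l ws)", OF z z] eq k by simp
    moreover have "b (z xs) (Suc (l ws)) = b (z (n # ws)) (Suc (l ws))"
      using anc[of "Suc (l ws)" "n # ws" "rev us"] l[of ws n] xs by simp
    moreover have "b (z ys) (Suc (l ws)) = b (z (m # ws)) (Suc (l ws))"
      using anc[of "Suc (l ws)" "m # ws" "rev vs"] l[of ws m] ys by simp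
    ultimately show False using injD[OF inj[of ws], of n m] d(1) by simp
  qed
  have valid_top: "valid xs (l xs)" for xs
    using l[of "tl xs" "hd xs"] by (cases xs) (auto simp: valid_def)
  \<comment> \<open>Both ends are listed; the first entry is \<open>\<phi> (tl xs)\<close> because
    \<open>z xs\<close> and \<open>z (tl xs)\<close> agree at radius
    \<open>l (tl xs)\<close>.\<close>
  define Q where "Q xs = map (b (z xs)) [l (tl xs)..<Suc (l xs)]" for xs
  \<comment> \<open>The description recovers the longer end of an edge, which is unique by
    \<open>T_inf_edge_unique\<close>.\<close>
  define P where "P e = Q (THE xs. xs \<noteq> [] \<and> e = {tl xs, xs})" for e
  have P: "P {tl xs, xs} = Q xs" if "xs \<noteq> []" for xs
  proof -
    have "(THE ys. ys \<noteq> [] \<and> {tl xs, xs} = {tl ys, ys}) = xs"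
      using that T_inf_edge_unique by (intro the_equality) auto
    then show ?thesis by (simp add: P_def)
  qed
  have ll: "l (tl xs) < l xs" if "xs \<noteq> []" for xs
    using that l[of "tl xs" "hd xs"] by simp
  have interior: "interior_verts (Q xs) = b (z xs) ` {l (tl xs)<..<l xs}" if "xs \<noteq> []" for xs
  proof -
    have "tl (Q xs) = map (b (z xs)) [Suc (l (tl xs))..<Suc (l xs)]"
      using ll[OF that] by (simp add: Q_def map_tl[symmetric] del: upt_Suc)
    then have "butlast (tl (Q xs)) = map (b (z xs)) [Suc (l (tl xs))..<l xs]"
      using ll[OF that] by simp
    then show ?thesis by (auto simp: interior_verts_def)
  qed
  define S where "S = \<lparr>verts = range \<phi> \<union> (\<Union>e\<in>edges T_inf. set (P e)),
      edges = (\<Union>e\<in>edges T_inf. path_edges (P e))\<rparr>"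
  have setQ: "set (Q xs) \<subseteq> types" for xs using z by (auto simp: Q_def types_def)
  have edgesQ: "\<exists>k. e = {b (z xs) k, b (z xs) (Suc k)} \<and> e \<subseteq> set (Q xs)" if "e \<in> path_edges (Q xs)" for e xs
  proof -
    obtain i where i: "Suc i < length (Q xs)" "e = {Q xs ! i, Q xs ! Suc i}"
      using \<open>e \<in> path_edges (Q xs)\<close> by (auto simp: path_edges_def)
    then have "e = {b (z xs) (l (tl xs) + i), b (z xs) (Suc (l (tl xs) + i))}"
      by (simp add: Q_def nth_append del: upt_Suc)
    moreover have "e \<subseteq> set (Q xs)" using i by auto
    ultimately show ?thesis by blast
  qed
  have "subgraph S type_tree"
    unfolding subgraph_def simple_graph_def
  proof (intro conjI ballI)
    show "verts S \<subseteq> verts type_tree"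
      using z setQ by (auto simp: S_def \<phi>_def type_tree_def types_def P_def) blast+
    fix e assume "e \<in> edges S"
    then obtain xs where xs: "xs \<noteq> []" "e \<in> path_edges (Q xs)" "e \<in> edges S"
      by (auto simp: S_def T_inf_edges P)
    then obtain k where k: "e = {b (z xs) k, b (z xs) (Suc k)}" "e \<subseteq> set (Q xs)" using edgesQ by blast
    have "b (z xs) k \<noteq> b (z xs) (Suc k)" using lev[OF z] by (metis n_not_Suc_n)
    then show "card e = 2" using k(1) by simp
    have "{tl xs, xs} \<in> edges T_inf" using xs(1) by (auto simp: T_inf_edges)
    then have "set (P {tl xs, xs}) \<subseteq> verts S" by (force simp: S_def)
    then show "e \<subseteq> verts S" using k(2) P[OF xs(1)] by simp
  next
    show "edges S \<subseteq> edges type_tree"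
    proof
      fix e assume "e \<in> edges S"
      then obtain xs where "e \<in> path_edges (Q xs)" by (auto simp: S_def P_def)
      then show "e \<in> edges type_tree" using edgesQ z by (fastforce simp: type_tree_def)
    qed
  qed
  moreover have "is_subdivision S T_inf"
    unfolding is_subdivision_def
  proof (intro exI[of _ \<phi>] exI[of _ P] conjI ballI impI)
    show "inj_on \<phi> (verts T_inf)"
      using unique[OF valid_top valid_top] by (auto simp: inj_on_def \<phi>_def)
    show "verts S = \<phi> ` verts T_inf \<union> (\<Union>e\<in>edges T_inf. set (P e))"
      by (simp add: S_def T_inf_def)
    show "edges S = (\<Union>e\<in>edges T_inf. path_edges (P e))" by (simp add: S_def)
  next
    fix e assume e: "e \<in> edges T_inf"
    then obtain xs where xs: "xs \<noteq> []" "e = {tl xs, xs}" by (auto simp: T_inf_edges)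
    have Pe: "P e = Q xs" using P xs by simp
    have ne: "Q xs \<noteq> []" using ll[OF xs(1)] by (simp add: Q_def)
    have "distinct (Q xs)"
      unfolding Q_def distinct_map using lev[OF z] by (metis distinct_upt inj_onI)
    moreover have "walk S (Q xs)"
      unfolding walk_def
    proof (intro conjI ne)
      show "set (Q xs) \<subseteq> verts S" using e Pe by (auto simp: S_def)
      have "path_edges (Q xs) \<subseteq> edges S" using e Pe by (auto simp: S_def)
      then show "successively (\<lambda>u v. {u, v} \<in> edges S) (Q xs)"
        by (auto simp: successively_conv_nth path_edges_def)
    qed
    ultimately show "simple_path S (P e)" by (simp add: Pe simple_path_def)
    have "hd (Q xs) = \<phi> (tl xs)"
      using ll[OF xs(1)] step[of "hd xs" "tl xs"] xs(1)
      by (simp add: Q_def hd_map \<phi>_def del: upt_Suc)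
    moreover have "last (Q xs) = \<phi> xs" using ll[OF xs(1)] by (simp add: Q_def \<phi>_def)
    ultimately show "{hd (P e), last (P e)} = \<phi> ` e" unfolding Pe unfolding xs(2) by simp
    show "interior_verts (P e) \<inter> \<phi> ` verts T_inf = {}"
    proof (rule ccontr)
      assume "\<not> ?thesis"
      then obtain k ys where k: "l (tl xs) < k" "k < l xs" "b (z xs) k = b (z ys) (l ys)"
        by (auto simp: Pe interior[OF xs(1)] \<phi>_def)
      then have "xs = ys" using unique[of xs k ys "l ys"] valid_top by (simp add: valid_def)
      then have "k = l xs" using k(3) lev[OF z] by metis
      then show False using k(2) by simp
    qed
    fix e' assume e': "e' \<in> edges T_inf" "e \<noteq> e'"
    then obtain ys where ys: "ys \<noteq> []" "e' = {tl ys, ys}" by (auto simp: T_inf_edges)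
    have Pe': "P e' = Q ys" using P ys by simp
    show "interior_verts (P e) \<inter> interior_verts (P e') = {}"
    proof (rule ccontr)
      assume "\<not> ?thesis"
      then obtain k k' where k: "l (tl xs) < k" "k < l xs" "l (tl ys) < k'" "k' < l ys"
          "b (z xs) k = b (z ys) k'"
        by (auto simp: Pe Pe' interior[OF xs(1)] interior[OF ys(1)])
      then have "xs = ys" using unique[of xs k ys k'] by (simp add: valid_def)
      then show False using e'(2) xs(2) ys(2) by simp
    qed
  qed
  ultimately show ?thesis by (auto simp: contains_subdivision_def)
qed

lemma contains_subdivision_iff_branching:
  "contains_subdivision type_tree T_inf \<longleftrightarrow> (\<exists>U. branching U)"
  using subdivision_imp_branching branching_imp_subdivision by blast

end

section \<open>Balls in graphs\<close>

text \<open>Vertex sets of balls, grown step by step to allow induction on the radius;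
  \<open>graph_dist_le_iff\<close> links them to the distance defined by walks.\<close>

primrec reach :: "'a ugraph \<Rightarrow> 'a \<Rightarrow> nat \<Rightarrow> 'a set" where
  "reach G v 0 = {v}"
| "reach G v (Suc r) = reach G v r \<union> {u. \<exists>w\<in>reach G v r. {w, u} \<in> edges G}"

lemma simple_graph_edgeD: "simple_graph G \<Longrightarrow> {u, w} \<in> edges G \<Longrightarrow> u \<in> verts G \<and> w \<in> verts G \<and> u \<noteq> w"
  unfolding simple_graph_def by fastforce

lemma simple_graph_edgeE:
  assumes "simple_graph G" "e \<in> edges G"
  obtains u w where "e = {u, w}" "u \<noteq> w" "u \<in> verts G" "w \<in> verts G"
proof -
  have "e \<subseteq> verts G" "card e = 2" using assms by (auto simp: simple_graph_def)
  then obtain u w where "e = {u, w}" "u \<noteq> w" by (auto simp: card_2_iff)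
  then show thesis using that \<open>e \<subseteq> verts G\<close> by auto
qed

lemma root_in_reach: "v \<in> reach G v r"
  by (induction r) auto

lemma reach_subset: "simple_graph G \<Longrightarrow> v \<in> verts G \<Longrightarrow> reach G v r \<subseteq> verts G"
  by (induction r) (auto dest: simple_graph_edgeD)

lemma reach_mono: "r \<le> s \<Longrightarrow> reach G v r \<subseteq> reach G v s"
  by (rule lift_Suc_mono_le[of "reach G v"]) auto

lemma finite_reach:
  assumes "simple_graph G" "locally_finite_graph G" "v \<in> verts G"
  shows "finite (reach G v r)"
proof (induction r)
  case (Suc r)
  have "reach G v (Suc r) = reach G v r \<union> (\<Union>w\<in>reach G v r. neighbours G w)"
    by (auto simp: neighbours_def insert_commute)
  moreover have "finite (neighbours G w)" if "w \<in> reach G v r" for w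
    using that assms reach_subset[OF assms(1,3)] unfolding locally_finite_graph_def by blast
  ultimately show ?case using Suc by simp
qed simp

lemma walk_snoc: "walk G (p @ [u]) \<Longrightarrow> p \<noteq> [] \<Longrightarrow> walk G p \<and> {last p, u} \<in> edges G"
  by (auto simp: walk_def successively_append_iff)

lemma last_walk_in_reach: "walk G p \<Longrightarrow> last p \<in> reach G (hd p) (length p - 1)"
proof (induction p rule: rev_induct)
  case (snoc u p)
  show ?case
  proof (cases "p = []")
    case False
    then have "last p \<in> reach G (hd p) (length p - 1)" "{last p, u} \<in> edges G"
      using snoc walk_snoc[of G p u] by auto
    then have "u \<in> reach G (hd p) (Suc (length p - 1))" by auto
    then show ?thesis using False by simp
  qed simp
qed (simp add: walk_def)

lemma reach_imp_walk:
  assumes G: "simple_graph G" "v \<in> verts G"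
  shows "u \<in> reach G v r \<Longrightarrow> \<exists>p. walk G p \<and> hd p = v \<and> last p = u \<and> length p \<le> Suc r"
proof (induction r arbitrary: u)
  case 0
  then show ?case using G by (intro exI[of _ "[v]"]) (simp add: walk_def)
next
  case (Suc r)
  show ?case
  proof (cases "u \<in> reach G v r")
    case True
    then show ?thesis using Suc.IH le_SucI by blast
  next
    case False
    then obtain w where w: "w \<in> reach G v r" "{w, u} \<in> edges G" using Suc.prems by auto
    then obtain p where "walk G p" "hd p = v" "last p = w" "length p \<le> Suc r" using Suc.IH by blast
    then show ?thesis using w simple_graph_edgeD[OF G(1) w(2)]
      by (intro exI[of _ "p @ [u]"]) (auto simp: walk_def successively_append_iff)
  qed
qed

lemma graph_dist_le_iff:
  assumes "simple_graph G" "v \<in> verts G"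
  shows "graph_dist G v u \<le> enat r \<longleftrightarrow> u \<in> reach G v r"
proof
  assume "graph_dist G v u \<le> enat r"
  then have "graph_dist G v u < enat (Suc r)" by (meson enat_ord_simps(2) lessI order_le_less_trans)
  then obtain p where p: "walk G p" "hd p = v" "last p = u" "length p - 1 \<le> r"
    by (auto simp: graph_dist_def INF_less_iff)
  then have "u \<in> reach G v (length p - 1)" using last_walk_in_reach[OF p(1)] by simp
  then show "u \<in> reach G v r" using reach_mono[OF p(4), of G v] by blast
next
  assume "u \<in> reach G v r"
  then obtain p where p: "walk G p" "hd p = v" "last p = u" "length p \<le> Suc r"
    using reach_imp_walk[OF assms] by blast
  then have "graph_dist G v u \<le> enat (length p - 1)"
    unfolding graph_dist_def by (intro INF_lower) simp
  also have "\<dots> \<le> enat r" using p(4) by simp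
  finally show "graph_dist G v u \<le> enat r" .
qed

lemma graph_ball_eq:
  "simple_graph G \<Longrightarrow> v \<in> verts G \<Longrightarrow> graph_ball (G, v) r = (induced_subgraph G (reach G v r), v)"
  by (simp add: graph_ball_def graph_dist_le_iff)

lemma verts_graph_ball:
  "simple_graph G \<Longrightarrow> v \<in> verts G \<Longrightarrow> verts (fst (graph_ball (G, v) r)) = reach G v r"
  using reach_subset[of G v r] by (auto simp: graph_ball_eq induced_subgraph_def)

lemma connected_graph_reach:
  assumes "connected_graph G" "v \<in> verts G" "u \<in> verts G"
  shows "\<exists>r. u \<in> reach G v r"
proof -
  obtain p where "walk G p" "hd p = v" "last p = u"
    using assms unfolding connected_graph_def by blast
  then show ?thesis using last_walk_in_reach[of G p] by blast
qed

lemma connected_graphI: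
  assumes G: "simple_graph G" "v \<in> verts G" and reach: "\<And>u. u \<in> verts G \<Longrightarrow> \<exists>r. u \<in> reach G v r"
  shows "connected_graph G"
  unfolding connected_graph_def
proof (intro conjI ballI)
  show "verts G \<noteq> {}" using G by blast
  fix u w assume "u \<in> verts G" "w \<in> verts G"
  then obtain p q where p: "walk G p" "hd p = v" "last p = u" and q: "walk G q" "hd q = v" "last q = w"
    using reach reach_imp_walk[OF G] by metis
  have ne: "p \<noteq> []" "q \<noteq> []" using p q by (auto simp: walk_def)
  have q_eq: "q = v # tl q" using q(2) ne(2) by (cases q) auto
  have sq: "successively (\<lambda>x y. {x, y} \<in> edges G) (v # tl q)" "set (tl q) \<subseteq> verts G"
    using q(1) q_eq unfolding walk_def by (metis, metis set_subset_Cons subset_trans)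
  have "successively (\<lambda>x y. {x, y} \<in> edges G) (rev p)" "set (rev p) \<subseteq> verts G" "last (rev p) = v"
    using p ne by (simp_all add: walk_def insert_commute last_rev)
  then have "walk G (rev p @ tl q)"
    using sq ne by (auto simp: walk_def successively_append_iff successively_Cons)
  moreover have "hd (rev p @ tl q) = u" using p ne by (simp add: hd_rev)
  moreover have "last (rev p @ tl q) = w"
    using q q_eq \<open>last (rev p) = v\<close> by (metis last_ConsL last_ConsR last_append self_append_conv)
  ultimately show "\<exists>p. walk G p \<and> hd p = u \<and> last p = w" by blast
qed

text \<open>Homomorphisms do not increase distances. Stated without injectivity or surjectivity,
  this serves both isomorphisms and embeddings into a host graph.\<close>

lemma reach_hom:
  assumes "\<And>x y. {x, y} \<in> edges G \<Longrightarrow> {f x, f y} \<in> edges H"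
  shows "f ` reach G v r \<subseteq> reach H (f v) r"
  using assms by (induction r) auto

lemma graph_iso_edge:
  assumes "graph_iso f G H" "{x, y} \<in> edges G"
  shows "{f x, f y} \<in> edges H"
proof -
  have "f ` {x, y} \<in> edges H" using assms unfolding graph_iso_def by blast
  then show ?thesis by simp
qed

lemma graph_iso_simple:
  assumes f: "graph_iso f G H" and G: "simple_graph G"
  shows "simple_graph H"
  unfolding simple_graph_def
proof
  fix e assume "e \<in> edges H"
  then obtain d where d: "d \<in> edges G" "e = f ` d" using f by (auto simp: graph_iso_def)
  then obtain u w where "d = {u, w}" "u \<noteq> w" "u \<in> verts G" "w \<in> verts G"
    using simple_graph_edgeE[OF G] by metis
  moreover from this have "f u \<noteq> f w" using f by (auto simp: graph_iso_def bij_betw_def dest: inj_onD)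
  ultimately show "e \<subseteq> verts H \<and> card e = 2" using f d(2)
    by (auto simp: graph_iso_def bij_betw_def)
qed

lemma graph_iso_reach:
  assumes f: "graph_iso f G H" and G: "simple_graph G" and v: "v \<in> verts G"
  shows "f ` reach G v r = reach H (f v) r"
proof
  show "f ` reach G v r \<subseteq> reach H (f v) r" by (rule reach_hom) (rule graph_iso_edge[OF f])
  let ?g = "inv_into (verts G) f"
  have fg: "f (?g u) = u" if "u \<in> verts H" for u
    using f that by (simp add: graph_iso_def bij_betw_def f_inv_into_f)
  have gv: "?g (f v) = v" using f v by (simp add: graph_iso_def bij_betw_def)
  have "?g ` reach H (f v) r \<subseteq> reach G v r"
    using reach_hom[of H ?g G "f v" r] graph_iso_edge[OF graph_iso_inv[OF f G]] gv by simp
  moreover have "f v \<in> verts H" using f v by (auto simp: graph_iso_def bij_betw_def)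
  then have "reach H (f v) r \<subseteq> verts H" by (rule reach_subset[OF graph_iso_simple[OF f G]])
  ultimately show "reach H (f v) r \<subseteq> f ` reach G v r" using fg by force
qed

lemma graph_iso_induced:
  assumes f: "graph_iso f G H" and G: "simple_graph G" and A: "A \<subseteq> verts G"
  shows "graph_iso f (induced_subgraph G A) (induced_subgraph H (f ` A))"
proof -
  have inj: "inj_on f (verts G)" and im: "f ` verts G = verts H" and e: "edges H = (\<lambda>e. f ` e) ` edges G"
    using f by (auto simp: graph_iso_def bij_betw_def)
  have "f ` d \<subseteq> f ` A \<longleftrightarrow> d \<subseteq> A" if "d \<in> edges G" for d
    using inj_on_image_subset_iff[OF inj _ A, of d] that G by (simp add: simple_graph_def)
  then have "{d \<in> edges H. d \<subseteq> f ` A} = (\<lambda>d. f ` d) ` {d \<in> edges G. d \<subseteq> A}"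
    unfolding e by blast
  moreover have "bij_betw f (verts G \<inter> A) (verts H \<inter> f ` A)"
    using A im inj by (auto simp: bij_betw_def inj_on_def)
  ultimately show ?thesis by (simp add: graph_iso_def induced_subgraph_def)
qed

text \<open>Growing the ball uses only edges between its own vertices, and these survive in the
  induced subgraph.\<close>

lemma reach_induced:
  assumes "reach G v r \<subseteq> W"
  shows "reach (induced_subgraph G W) v r = reach G v r"
  using assms
proof (induction r)
  case (Suc r)
  then have "reach (induced_subgraph G W) v r = reach G v r" by auto
  moreover have "{w, u} \<in> edges (induced_subgraph G W) \<longleftrightarrow> {w, u} \<in> edges G"
    if "w \<in> reach G v r" for w u
    using that Suc.prems by (auto simp: induced_subgraph_def)
  ultimately show ?case by auto
qed simp

lemma induced_induced: "B \<subseteq> A \<Longrightarrow> induced_subgraph (induced_subgraph G A) B = induced_subgraph G B"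
  by (auto simp: induced_subgraph_def)

text \<open>A ball determines all smaller balls around its centre; this is the source of
  coherence.\<close>

lemma graph_ball_ball:
  assumes "x \<in> rooted_graphs" "r \<le> s"
  shows "graph_ball (graph_ball x s) r = graph_ball x r"
proof -
  obtain G v where x: "x = (G, v)" by (cases x)
  then have G: "simple_graph G" "v \<in> verts G" using assms by (auto simp: rooted_graphs_def)
  have b: "graph_ball x s = (induced_subgraph G (reach G v s), v)" using G x by (simp add: graph_ball_eq)
  then have "(induced_subgraph G (reach G v s), v) \<in> rooted_graphs"
    using graph_ball_rooted[OF assms(1), of s] by simp
  then show ?thesis
    using b x G reach_mono[OF assms(2), of G v]
    by (simp add: rooted_graphs_def graph_ball_eq reach_induced induced_induced)
qed

section \<open>Relabelled copies and rooted isomorphisms\<close>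

lemma image_graph_iso:
  assumes "inj_on h (verts G)"
  shows "graph_iso h G \<lparr>verts = h ` verts G, edges = (\<lambda>e. h ` e) ` edges G\<rparr>"
  using assms by (simp add: graph_iso_def bij_betw_def)

lemma rooted_isoI:
  assumes "graph_iso f G H" "simple_graph G" "v \<in> verts G"
  shows "((G, v), (H, f v)) \<in> rooted_iso"
  using assms graph_iso_simple[OF assms(1,2)]
  by (auto simp: rooted_iso_def rooted_graphs_def graph_iso_def bij_betw_def)

lemma rooted_isoE:
  assumes "(x, y) \<in> rooted_iso"
  obtains G v H f where "x = (G, v)" "y = (H, f v)" "simple_graph G" "simple_graph H" "v \<in> verts G"
    "f v \<in> verts H" "graph_iso f G H"
  using assms by (auto simp: rooted_iso_def rooted_graphs_def)

lemma rooted_iso_sym: "(x, y) \<in> rooted_iso \<Longrightarrow> (y, x) \<in> rooted_iso"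
  using equiv_rooted_iso by (meson equivE symE)

lemma rooted_iso_trans: "(x, y) \<in> rooted_iso \<Longrightarrow> (y, z) \<in> rooted_iso \<Longrightarrow> (x, z) \<in> rooted_iso"
  using equiv_rooted_iso by (meson equivE transE)

lemma rooted_iso_refl: "x \<in> rooted_graphs \<Longrightarrow> (x, x) \<in> rooted_iso"
  using equiv_rooted_iso by (meson equivE refl_onD)

lemma rooted_iso_dom: "(x, y) \<in> rooted_iso \<Longrightarrow> x \<in> rooted_graphs \<and> y \<in> rooted_graphs"
  by (auto simp: rooted_iso_def)

section \<open>Limits of rooted graphs\<close>

text \<open>The ball in \<open>x\<close> is relabelled by the given isomorphism, the rest of
  \<open>x\<close> by labels outside \<open>B\<close>; finiteness of \<open>B\<close> leaves
  infinitely many of them. This turns agreement of balls up to isomorphism into equality.\<close>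

lemma relabel_to_extend_ball:
  assumes fin: "finite (verts (fst B))" and iso: "(graph_ball x r, B) \<in> rooted_iso" and x: "x \<in> rooted_graphs"
  shows "\<exists>y. (y, x) \<in> rooted_iso \<and> graph_ball y r = B"
proof -
  obtain G v where xG: "x = (G, v)" by (cases x)
  then have G: "simple_graph G" "v \<in> verts G" using x by (auto simp: rooted_graphs_def)
  let ?D = "reach G v r"
  have D: "?D \<subseteq> verts G" by (rule reach_subset[OF G])
  have ball: "graph_ball x r = (induced_subgraph G ?D, v)" using xG G by (simp add: graph_ball_eq)
  obtain g where g: "graph_iso g (induced_subgraph G ?D) (fst B)" "g v = snd B"
    using iso unfolding ball by (elim rooted_isoE) auto
  have gD: "bij_betw g ?D (verts (fst B))" and eB: "edges (fst B) = (\<lambda>e. g ` e) ` {e \<in> edges G. e \<subseteq> ?D}"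
    using g(1) D by (auto simp: graph_iso_def induced_subgraph_def Int_absorb1)
  have "infinite (- verts (fst B))" using fin by (simp add: Compl_eq_Diff_UNIV Diff_infinite_finite)
  then obtain j :: "nat \<Rightarrow> nat" where j: "inj j" "range j \<subseteq> - verts (fst B)"
    using infinite_countable_subset by blast
  define h where "h u = (if u \<in> ?D then g u else j u)" for u
  have hD: "h u = g u" if "u \<in> ?D" for u using that by (simp add: h_def)
  have inj: "inj_on h (verts G)"
  proof (rule inj_onI)
    fix u w assume eq: "h u = h w"
    have fresh: "g u \<noteq> j w" if "u \<in> ?D" for u w
      using bij_betwE[OF gD] that j(2) by blast
    show "u = w"
    proof (cases "u \<in> ?D")
      case True
      then have "w \<in> ?D" "g u = g w" using eq fresh[of u w] by (auto simp: h_def split: if_splits)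
      then show ?thesis using True inj_onD[OF bij_betw_imp_inj_on[OF gD]] by blast
    next
      case False
      then have "j u = j w" using eq fresh[of w u] by (auto simp: h_def split: if_splits)
      then show ?thesis by (rule injD[OF j(1)])
    qed
  qed
  define H where "H = \<lparr>verts = h ` verts G, edges = (\<lambda>e. h ` e) ` edges G\<rparr>"
  have h: "graph_iso h G H" unfolding H_def by (rule image_graph_iso[OF inj])
  have H: "simple_graph H" "h v \<in> verts H" using graph_iso_simple[OF h G(1)] G(2) by (auto simp: H_def)
  have hv: "h v = snd B" using g(2) hD[OF root_in_reach] by simp
  have rH: "reach H (h v) r = h ` ?D" using graph_iso_reach[OF h G] by simp
  have "h ` ?D = g ` ?D" using hD by simp
  then have hDB: "h ` ?D = verts (fst B)" using gD by (simp add: bij_betw_def)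
  have "graph_iso h (induced_subgraph G ?D) (induced_subgraph H (h ` ?D))"
    by (rule graph_iso_induced[OF h G(1) D])
  then have "edges (induced_subgraph H (h ` ?D)) = (\<lambda>e. h ` e) ` {e \<in> edges G. e \<subseteq> ?D}"
    by (simp add: graph_iso_def induced_subgraph_def)
  also have "\<dots> = edges (fst B)"
    unfolding eB using hD by (intro image_cong refl) (auto simp: subset_eq image_iff)
  finally have "edges (induced_subgraph H (h ` ?D)) = edges (fst B)" .
  moreover have "verts (induced_subgraph H (h ` ?D)) = verts (fst B)"
    using hDB D by (auto simp: induced_subgraph_def H_def)
  ultimately have "induced_subgraph H (h ` ?D) = fst B" by simp
  then have "graph_ball (H, h v) r = B"
    unfolding graph_ball_eq[OF H] rH using hv by (simp add: prod_eq_iff)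
  moreover have "((H, h v), x) \<in> rooted_iso"
    using rooted_iso_sym[OF rooted_isoI[OF h G]] xG by simp
  ultimately show ?thesis by blast
qed

text \<open>After relabelling, the balls of a coherent sequence are literally nested, so that the limit is
  their union.\<close>

lemma limit_of_nested_balls:
  assumes y: "\<And>r. y r \<in> rooted_graphs" and fin: "\<And>r. finite (verts (fst (graph_ball (y r) r)))"
    and nested: "\<And>r. graph_ball (y (Suc r)) r = graph_ball (y r) r"
  shows "\<exists>G v. G \<in> G_inf \<and> v \<in> verts G \<and> (\<forall>r. graph_ball (G, v) r = graph_ball (y r) r)"
proof -
  have stable: "graph_ball (y s) r = graph_ball (y r) r" if "r \<le> s" for r s
    using that
  proof (induction rule: dec_induct)
    case (step s)
    have "graph_ball (y (Suc s)) r = graph_ball (graph_ball (y (Suc s)) s) r"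
      using graph_ball_ball[OF y] step(1) by simp
    also have "\<dots> = graph_ball (y s) r" using graph_ball_ball[OF y] step(1) by (simp add: nested)
    finally show ?case using step by simp
  qed simp
  define Y where "Y r = fst (y r)" for r
  define v where "v = snd (y 0)"
  have snd_ball: "snd (graph_ball (y r) 0) = snd (y r)" for r by (cases "y r") (simp add: graph_ball_def)
  have "snd (y r) = v" for r
    using snd_ball[of r] snd_ball[of 0] stable[of 0 r] by (simp add: v_def)
  then have yY: "y r = (Y r, v)" for r by (simp add: Y_def prod_eq_iff)
  have Y: "simple_graph (Y r)" "v \<in> verts (Y r)" for r
    using y[of r] by (auto simp: yY rooted_graphs_def)
  define D where "D r = reach (Y r) v r" for r
  define E where "E r = {e \<in> edges (Y r). e \<subseteq> D r}" for r
  have D: "reach (Y s) v r = D r" if "r \<le> s" for r s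
    using verts_graph_ball[OF Y, of s r] verts_graph_ball[OF Y, of r r] stable[OF that]
    by (simp add: yY D_def)
  have E: "{e \<in> edges (Y s). e \<subseteq> D r} = E r" if "r \<le> s" for r s
    using stable[OF that] D[OF that] D[of r r]
    by (simp add: yY graph_ball_eq[OF Y] induced_subgraph_def E_def)
  have D_mono: "D r \<subseteq> D s" if "r \<le> s" for r s
    using reach_mono[OF that, of "Y s" v] D[OF that] D[of s s] by simp
  have E_mono: "E r \<subseteq> E s" if "r \<le> s" for r s
    using E[OF that] D_mono[OF that] by (auto simp: E_def)
  define G where "G = \<lparr>verts = \<Union>r. D r, edges = \<Union>r. E r\<rparr>"
  have G: "simple_graph G"
    using Y(1) by (auto simp: simple_graph_def G_def E_def)
  have "v \<in> D 0" by (simp add: D_def)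
  then have vG: "v \<in> verts G" by (auto simp: G_def)
  \<comment> \<open>The radius goes up by one since an edge at a vertex of \<open>D k\<close> may
    leave \<open>D k\<close>, but not \<open>D (Suc k)\<close>.\<close>
  have edge_iff: "{w, u} \<in> edges G \<longleftrightarrow> {w, u} \<in> edges (Y (Suc k))" if w: "w \<in> D k" for w u k
  proof
    assume "{w, u} \<in> edges G"
    then obtain s0 where "{w, u} \<in> E s0" by (auto simp: G_def)
    then have "{w, u} \<in> E (max s0 (Suc k))" using E_mono[of s0 "max s0 (Suc k)"] by auto
    moreover define s where "s = max s0 (Suc k)"
    ultimately have s: "{w, u} \<in> edges (Y s)" "Suc k \<le> s" by (auto simp: E_def)
    have "w \<in> reach (Y s) v k" using w D[of k s] s(2) by simp
    then have "u \<in> reach (Y s) v (Suc k)" using s(1) by auto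
    then have "{w, u} \<subseteq> D (Suc k)" using D[OF s(2)] w D_mono[of k "Suc k"] by auto
    then have "{w, u} \<in> E (Suc k)" using s(1) E[OF s(2)] by blast
    then show "{w, u} \<in> edges (Y (Suc k))" by (simp add: E_def)
  next
    assume e: "{w, u} \<in> edges (Y (Suc k))"
    have "w \<in> reach (Y (Suc k)) v k" using w D[of k "Suc k"] by simp
    then have "u \<in> D (Suc k)" using e by (auto simp: D_def)
    then have "{w, u} \<in> E (Suc k)" using e w D_mono[of k "Suc k"] by (auto simp: E_def)
    then show "{w, u} \<in> edges G" by (auto simp: G_def)
  qed
  have reach: "reach G v r = D r" for r
  proof (induction r)
    case 0
    then show ?case by (simp add: D_def)
  next
    case (Suc r)
    have "reach G v (Suc r) = D r \<union> {u. \<exists>w\<in>D r. {w, u} \<in> edges (Y (Suc r))}"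
      using Suc edge_iff by auto
    also have "\<dots> = reach (Y (Suc r)) v (Suc r)" using D[of r "Suc r"] by simp
    finally show ?case by (simp add: D_def)
  qed
  have E_eq: "{e \<in> edges G. e \<subseteq> D r} = E r" for r
  proof
    show "{e \<in> edges G. e \<subseteq> D r} \<subseteq> E r"
    proof
      fix e assume "e \<in> {e \<in> edges G. e \<subseteq> D r}"
      then obtain s where "e \<in> E s" "e \<subseteq> D r" by (auto simp: G_def)
      then have "e \<in> E (max s r)" using E_mono[of s "max s r"] by auto
      then have "e \<in> {e \<in> edges (Y (max s r)). e \<subseteq> D r}" using \<open>e \<subseteq> D r\<close> by (simp add: E_def)
      then show "e \<in> E r" using E[of r "max s r"] by simp
    qed
  qed (auto simp: G_def E_def)
  have "graph_ball (G, v) r = graph_ball (y r) r" for r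
  proof -
    have "verts G \<inter> D r = D r" by (auto simp: G_def)
    moreover have "verts (Y r) \<inter> D r = D r" using reach_subset[OF Y] by (auto simp: D_def)
    ultimately show ?thesis
      using E_eq[of r] by (simp add: yY graph_ball_eq[OF Y] graph_ball_eq[OF G vG] reach induced_subgraph_def
          D_def[symmetric] E_def[symmetric])
  qed
  moreover have "connected_graph G"
  proof (rule connected_graphI[OF G vG])
    fix u assume "u \<in> verts G"
    then show "\<exists>r. u \<in> reach G v r" unfolding reach by (simp add: G_def)
  qed
  moreover have "locally_finite_graph G"
    unfolding locally_finite_graph_def
  proof
    fix u assume "u \<in> verts G"
    then obtain r where "u \<in> D r" by (auto simp: G_def)
    then have "neighbours G u \<subseteq> reach G v (Suc r)"
      using reach[of r] by (auto simp: neighbours_def insert_commute)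
    moreover have "finite (reach G v (Suc r))"
      using fin[of "Suc r"] unfolding yY verts_graph_ball[OF Y] reach D_def .
    ultimately show "finite (neighbours G u)" by (rule finite_subset)
  qed
  ultimately show ?thesis using G vG by (auto simp: G_inf_def)
qed

text \<open>The \<open>z r\<close> are replaced one after another by isomorphic copies, each
  relabelled to contain literally the ball fixed in the preceding step.\<close>

lemma limit_of_balls:
  assumes z: "\<And>r. z r \<in> rooted_graphs" and fin: "\<And>r. finite (verts (fst (graph_ball (z r) r)))"
    and coherent: "\<And>r. (graph_ball (z (Suc r)) r, graph_ball (z r) r) \<in> rooted_iso"
  shows "\<exists>G v. G \<in> G_inf \<and> v \<in> verts G \<and> (\<forall>r. (graph_ball (G, v) r, graph_ball (z r) r) \<in> rooted_iso)"
proof -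
  have fin': "finite (verts (fst (graph_ball y r)))" if "(y, z r) \<in> rooted_iso" for y r
  proof -
    have "(graph_ball y r, graph_ball (z r) r) \<in> rooted_iso" by (rule graph_ball_iso[OF that])
    then show ?thesis using fin[of r]
      by (elim rooted_isoE) (auto simp: graph_iso_def bij_betw_finite)
  qed
  have "\<exists>y. \<forall>r. (y r, z r) \<in> rooted_iso \<and> graph_ball (y (Suc r)) r = graph_ball (y r) r"
  proof (rule dependent_nat_choice)
    show "\<exists>y. (y, z 0) \<in> rooted_iso" using rooted_iso_refl[OF z] by blast
  next
    fix y r assume y: "(y, z r) \<in> rooted_iso"
    have "(graph_ball (z (Suc r)) r, graph_ball y r) \<in> rooted_iso"
      using coherent rooted_iso_sym[OF graph_ball_iso[OF y]] rooted_iso_trans by blast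
    then show "\<exists>y'. (y', z (Suc r)) \<in> rooted_iso \<and> graph_ball y' r = graph_ball y r"
      using relabel_to_extend_ball[OF fin'[OF y]] z by blast
  qed
  then obtain y where y: "\<And>r. (y r, z r) \<in> rooted_iso" "\<And>r. graph_ball (y (Suc r)) r = graph_ball (y r) r"
    by blast
  have "\<exists>G v. G \<in> G_inf \<and> v \<in> verts G \<and> (\<forall>r. graph_ball (G, v) r = graph_ball (y r) r)"
    by (rule limit_of_nested_balls) (use y rooted_iso_dom fin' in blast)+
  then obtain G v where G: "G \<in> G_inf" "v \<in> verts G" "\<And>r. graph_ball (G, v) r = graph_ball (y r) r"
    by blast
  have "(graph_ball (G, v) r, graph_ball (z r) r) \<in> rooted_iso" for r
    unfolding G(3) by (rule graph_ball_iso[OF y(1)])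
  then show ?thesis using G by blast
qed

text \<open>A point of the inverse limit of nonempty finite sets. The maps \<open>\<pi>\<close> may
  fail to be onto, so elements \<open>z k\<close> of ever higher levels are projected down, and the
  pigeonhole principle selects at each level a value shared by infinitely many of the projections
  kept so far.\<close>

lemma koenig:
  assumes fin: "\<And>r. finite (F r)" and ne: "\<And>r. F r \<noteq> {}"
    and \<pi>: "\<And>r t. t \<in> F (Suc r) \<Longrightarrow> \<pi> r t \<in> F r"
  shows "\<exists>s. \<forall>r. s r \<in> F r \<and> \<pi> r (s (Suc r)) = s r"
proof -
  have "\<forall>k. \<exists>t. t \<in> F k" using ne by (simp add: ex_in_conv)
  from choice[OF this] obtain z where z: "\<And>k. z k \<in> F k" by blast
  \<comment> \<open>Here \<open>d\<close> counts the steps down from level \<open>k\<close>, so that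
    \<open>a k r\<close> below is the projection of \<open>z k\<close> to level
    \<open>r\<close>.\<close>
  define a' where "a' k d = rec_nat (z k) (\<lambda>d t. \<pi> (k - Suc d) t) d" for k d
  have a'0: "a' k 0 = z k" and a'Suc: "a' k (Suc d) = \<pi> (k - Suc d) (a' k d)" for k d
    by (simp_all add: a'_def)
  define a where "a k r = a' k (k - r)" for k r
  have step: "a k r = \<pi> r (a k (Suc r))" if "r < k" for k r
  proof -
    have "k - r = Suc (k - Suc r)" "k - Suc (k - Suc r) = r" using that by auto
    then show ?thesis unfolding a_def by (metis a'Suc)
  qed
  have a_in: "a k r \<in> F r" if "r \<le> k" for k r
    using that
  proof (induction rule: inc_induct)
    case base
    then show ?case using z by (simp add: a_def a'0)
  next
    case (step n)
    then show ?case using \<open>\<And>r k. r < k \<Longrightarrow> a k r = \<pi> r (a k (Suc r))\<close>[of n k] \<pi> by simp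
  qed
  have split: "\<exists>t\<in>F r. infinite {k \<in> A. a k r = t}" if A: "infinite A" "\<And>k. k \<in> A \<Longrightarrow> r \<le> k" for A r
    using pigeonhole_infinite_rel[OF A(1) fin[of r], of "\<lambda>k t. a k r = t"] a_in A(2) by auto
  have "\<exists>s. \<forall>r. (s r \<in> F r \<and> infinite {k. r \<le> k \<and> a k r = s r}) \<and> \<pi> r (s (Suc r)) = s r"
  proof (rule dependent_nat_choice)
    show "\<exists>t. t \<in> F 0 \<and> infinite {k. 0 \<le> k \<and> a k 0 = t}"
      using split[of UNIV 0] by auto
  next
    fix t r assume t: "t \<in> F r \<and> infinite {k. r \<le> k \<and> a k r = t}"
    \<comment> \<open>Removing \<open>r\<close> leaves indices of at least \<open>Suc r\<close>, for
      which level \<open>Suc r\<close> is defined by projection.\<close>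
    let ?A = "{k. r \<le> k \<and> a k r = t} - {r}"
    have "infinite ?A" using t by simp
    then obtain t' where t': "t' \<in> F (Suc r)" "infinite {k \<in> ?A. a k (Suc r) = t'}"
      using split[of ?A "Suc r"] by force
    then obtain k where "k \<in> ?A" "a k (Suc r) = t'" using infinite_imp_nonempty by blast
    then have "\<pi> r t' = t" using step[of r k] by auto
    moreover have "infinite {k. Suc r \<le> k \<and> a k (Suc r) = t'}"
      by (rule infinite_super[OF _ t'(2)]) auto
    ultimately show "\<exists>t'. (t' \<in> F (Suc r) \<and> infinite {k. Suc r \<le> k \<and> a k (Suc r) = t'}) \<and> \<pi> r t' = t"
      using t'(1) by blast
  qed
  then show ?thesis by blast
qed

text \<open>By local finiteness there are finitely many rooted isomorphisms between the balls of
  radius \<open>r\<close>, and each restricts to the smaller balls. A compatible choice for all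
  radii glues to an isomorphism of the graphs, because in connected graphs the balls exhaust
  everything.\<close>

lemma rooted_iso_if_balls_iso:
  assumes G: "G \<in> G_inf" "v \<in> verts G" and H: "H \<in> G_inf" "w \<in> verts H"
    and balls: "\<And>r. (graph_ball (G, v) r, graph_ball (H, w) r) \<in> rooted_iso"
  shows "((G, v), (H, w)) \<in> rooted_iso"
proof -
  have sG: "simple_graph G" "connected_graph G" "locally_finite_graph G"
    and sH: "simple_graph H" "connected_graph H" "locally_finite_graph H"
    using G H by (auto simp: G_inf_def)
  let ?A = "reach G v" and ?B = "reach H w"
  note A = reach_subset[OF sG(1) G(2)] and B = reach_subset[OF sH(1) H(2)]
  have iso_iff: "graph_iso f (induced_subgraph G (?A r)) (induced_subgraph H (?B r)) \<longleftrightarrow>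
      bij_betw f (?A r) (?B r) \<and> {e \<in> edges H. e \<subseteq> ?B r} = (\<lambda>e. f ` e) ` {e \<in> edges G. e \<subseteq> ?A r}" for f r
    using A[of r] B[of r] by (simp add: graph_iso_def induced_subgraph_def Int_absorb1)
  \<comment> \<open>Extensionality fixes the values outside the ball; this makes \<open>F r\<close>
    finite and lets restrictions be compared as functions.\<close>
  define F where "F r = {f \<in> extensional (?A r). f v = w \<and>
      graph_iso f (induced_subgraph G (?A r)) (induced_subgraph H (?B r))}" for r
  have restrict_iso: "graph_iso (restrict f (?A r)) (induced_subgraph G (?A r)) (induced_subgraph H (?B r))"
    if "graph_iso f (induced_subgraph G (?A r)) (induced_subgraph H (?B r))" for f r
  proof -
    have "(\<lambda>e. restrict f (?A r) ` e) ` {e \<in> edges G. e \<subseteq> ?A r} = (\<lambda>e. f ` e) ` {e \<in> edges G. e \<subseteq> ?A r}"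
      by (intro image_cong refl) (auto simp: subset_eq image_iff)
    moreover have "bij_betw (restrict f (?A r)) (?A r) (?B r) = bij_betw f (?A r) (?B r)"
      by (rule bij_betw_cong) simp
    ultimately show ?thesis using that unfolding iso_iff by simp
  qed
  have "\<exists>s. \<forall>r. s r \<in> F r \<and> restrict (s (Suc r)) (?A r) = s r"
  proof (rule koenig[where \<pi> = "\<lambda>r f. restrict f (?A r)"])
    fix r
    have "F r \<subseteq> Pi\<^sub>E (?A r) (\<lambda>_. ?B r)"
      unfolding F_def iso_iff by (auto simp: PiE_def bij_betw_def)
    then show "finite (F r)"
      using finite_PiE[of "?A r" "\<lambda>_. ?B r"] finite_reach[OF sG(1,3) G(2)] finite_reach[OF sH(1,3) H(2)]
      by (meson finite_subset)
    obtain f where "graph_iso f (induced_subgraph G (?A r)) (induced_subgraph H (?B r))" "f v = w"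
      using balls[of r] unfolding graph_ball_eq[OF sG(1) G(2)] graph_ball_eq[OF sH(1) H(2)]
      by (elim rooted_isoE) auto
    then have "restrict f (?A r) \<in> F r"
      using restrict_iso root_in_reach[of v G r] by (simp add: F_def)
    then show "F r \<noteq> {}" by blast
    fix f assume f: "f \<in> F (Suc r)"
    let ?G' = "induced_subgraph G (?A (Suc r))" and ?H' = "induced_subgraph H (?B (Suc r))"
    have f': "graph_iso f ?G' ?H'" "f v = w" using f by (auto simp: F_def)
    have AA: "?A r \<subseteq> ?A (Suc r)" "?B r \<subseteq> ?B (Suc r)" by auto
    have sG': "simple_graph ?G'" "v \<in> verts ?G'" "?A r \<subseteq> verts ?G'"
      using sG(1) A[of r] G(2) root_in_reach[of v G "Suc r"]
      by (auto simp: simple_graph_def induced_subgraph_def)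
    have "f ` ?A r = ?B r"
      using graph_iso_reach[OF f'(1) sG'(1,2), of r] f'(2) AA by (simp add: reach_induced)
    then have "graph_iso f (induced_subgraph G (?A r)) (induced_subgraph H (?B r))"
      using graph_iso_induced[OF f'(1) sG'(1,3)] AA by (simp add: induced_induced)
    then show "restrict f (?A r) \<in> F r"
      using restrict_iso f'(2) root_in_reach[of v G r] by (simp add: F_def)
  qed
  then obtain s where s: "\<And>r. s r \<in> F r" "\<And>r. restrict (s (Suc r)) (?A r) = s r" by blast
  have s_step: "s (Suc r) u = s r u" if "u \<in> ?A r" for r u
    using s(2)[of r] that by (metis restrict_apply')
  have s_eq: "s k u = s r u" if "u \<in> ?A r" "r \<le> k" for r k u
    using that(2)
  proof (induction rule: dec_induct)
    case (step k)
    then show ?case using s_step[of u k] that(1) reach_mono[of r k G v] by auto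
  qed simp
  define rk where "rk u = (LEAST r. u \<in> ?A r)" for u
  define f where "f u = s (rk u) u" for u
  have f_eq: "f u = s r u" if "u \<in> ?A r" for r u
    unfolding f_def rk_def using LeastI[of "\<lambda>r. u \<in> ?A r", OF that] Least_le[of "\<lambda>r. u \<in> ?A r", OF that]
    by (intro s_eq[symmetric])
  have f_iso: "bij_betw f (?A r) (?B r)" "{e \<in> edges H. e \<subseteq> ?B r} = (\<lambda>e. f ` e) ` {e \<in> edges G. e \<subseteq> ?A r}" for r
  proof -
    have *: "bij_betw (s r) (?A r) (?B r) \<and> {e \<in> edges H. e \<subseteq> ?B r} = (\<lambda>e. s r ` e) ` {e \<in> edges G. e \<subseteq> ?A r}"
      using s(1)[of r] by (simp add: F_def iso_iff)
    have "bij_betw f (?A r) (?B r) = bij_betw (s r) (?A r) (?B r)"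
      by (rule bij_betw_cong) (rule f_eq)
    then show "bij_betw f (?A r) (?B r)" using * by simp
    have "(\<lambda>e. f ` e) ` {e \<in> edges G. e \<subseteq> ?A r} = (\<lambda>e. s r ` e) ` {e \<in> edges G. e \<subseteq> ?A r}"
      using f_eq by (intro image_cong refl) (auto simp: subset_eq image_iff)
    then show "{e \<in> edges H. e \<subseteq> ?B r} = (\<lambda>e. f ` e) ` {e \<in> edges G. e \<subseteq> ?A r}" using * by simp
  qed
  have VG: "verts G = (\<Union>r. ?A r)" using A connected_graph_reach[OF sG(2) G(2)] by blast
  have VH: "verts H = (\<Union>r. ?B r)" using B connected_graph_reach[OF sH(2) H(2)] by blast
  have exhaust: "\<exists>r. e \<subseteq> reach K x r" if K: "simple_graph K" "connected_graph K" "x \<in> verts K" "e \<in> edges K"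
    for K :: "nat ugraph" and x e
  proof -
    obtain a c where ac: "e = {a, c}" "a \<in> verts K" "c \<in> verts K"
      using simple_graph_edgeE[OF K(1,4)] by metis
    then obtain r r' where "a \<in> reach K x r" "c \<in> reach K x r'"
      using connected_graph_reach[OF K(2,3)] by metis
    then have "e \<subseteq> reach K x (max r r')"
      using ac(1) reach_mono[of r "max r r'" K x] reach_mono[of r' "max r r'" K x] by auto
    then show ?thesis by blast
  qed
  have "bij_betw f (verts G) (verts H)"
    unfolding VG VH
  proof (rule bij_betw_UNION_chain)
    show "?A r \<subseteq> ?A r' \<or> ?A r' \<subseteq> ?A r" for r r'
      using reach_mono[of r r' G v] reach_mono[of r' r G v] nat_le_linear[of r r'] by blast
  qed (rule f_iso(1))
  moreover have "edges H = (\<lambda>e. f ` e) ` edges G"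
  proof
    show "edges H \<subseteq> (\<lambda>e. f ` e) ` edges G"
    proof
      fix d assume d: "d \<in> edges H"
      then obtain r where "d \<subseteq> ?B r" using exhaust[OF sH(1,2) H(2)] by blast
      then have "d \<in> {e \<in> edges H. e \<subseteq> ?B r}" using d by simp
      also have "\<dots> \<subseteq> (\<lambda>e. f ` e) ` edges G" unfolding f_iso(2) by (rule image_mono) simp
      finally show "d \<in> (\<lambda>e. f ` e) ` edges G" .
    qed
    show "(\<lambda>e. f ` e) ` edges G \<subseteq> edges H"
    proof
      fix d assume "d \<in> (\<lambda>e. f ` e) ` edges G"
      then obtain e where e: "d = f ` e" "e \<in> edges G" by (rule imageE)
      then obtain r where "e \<subseteq> ?A r" using exhaust[OF sG(1,2) G(2)] by blast
      then have "d \<in> (\<lambda>e. f ` e) ` {e \<in> edges G. e \<subseteq> ?A r}" using e by simp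
      then show "d \<in> edges H" unfolding f_iso(2)[symmetric] by simp
    qed
  qed
  moreover have "f v = w" using f_eq[of v 0] s(1)[of 0] by (simp add: F_def)
  ultimately show ?thesis using rooted_isoI[of f G H v] sG(1) G(2) by (simp add: graph_iso_def)
qed

section \<open>Layered graphs\<close>

text \<open>The vertex \<open>prod_encode (r, i)\<close> is the \<open>i\<close>-th vertex of layer \<open>r\<close>.\<close>

definition layered_graph :: "(nat \<Rightarrow> nat) \<Rightarrow> nat ugraph" where
  "layered_graph M = \<lparr>verts = {prod_encode p | p. snd p < M (fst p)},
     edges = {{prod_encode p, prod_encode q} | p q. snd p < M (fst p) \<and> snd q < M (fst q) \<and> p \<noteq> q \<and>
       fst p \<le> Suc (fst q) \<and> fst q \<le> Suc (fst p)}\<rparr>"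

lemma layered_graph_edge_iff:
  "{prod_encode p, prod_encode q} \<in> edges (layered_graph M) \<longleftrightarrow>
     snd p < M (fst p) \<and> snd q < M (fst q) \<and> p \<noteq> q \<and> fst p \<le> Suc (fst q) \<and> fst q \<le> Suc (fst p)"
  (is "?L \<longleftrightarrow> ?R p q")
proof
  assume ?L
  then obtain p' q' where pq: "{prod_encode p, prod_encode q} = {prod_encode p', prod_encode q'}" "?R p' q'"
    unfolding layered_graph_def by auto
  then have "p = p' \<and> q = q' \<or> p = q' \<and> q = p'" by (auto simp: doubleton_eq_iff prod_encode_eq)
  then show "?R p q" using pq(2) by auto
next
  assume "?R p q"
  then show ?L unfolding layered_graph_def ugraph.simps by blast
qed

lemma layered_graph_vert_iff: "prod_encode p \<in> verts (layered_graph M) \<longleftrightarrow> snd p < M (fst p)"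
  by (cases p) (auto simp: layered_graph_def prod_encode_eq)

text \<open>Nonempty layers provide a spine of vertices with number 0, to which all vertices of
  their layers are joined. Degrees are finite since edges do not skip layers.\<close>

lemma layered_graph_in_G_inf:
  assumes M: "\<And>r. 0 < M r"
  shows "layered_graph M \<in> G_inf"
proof -
  let ?H = "layered_graph M"
  have S: "simple_graph ?H"
    unfolding simple_graph_def
  proof
    fix e assume "e \<in> edges ?H"
    then obtain p q where "e = {prod_encode p, prod_encode q}" "p \<noteq> q" "snd p < M (fst p)" "snd q < M (fst q)"
      unfolding layered_graph_def ugraph.simps by blast
    then show "e \<subseteq> verts ?H \<and> card e = 2"
      by (simp add: layered_graph_vert_iff prod_encode_eq)
  qed
  have root: "prod_encode (0, 0) \<in> verts ?H" using M by (simp add: layered_graph_vert_iff)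
  have spine: "prod_encode (r, 0) \<in> reach ?H (prod_encode (0, 0)) r" for r
  proof (induction r)
    case (Suc r)
    have "{prod_encode (r, 0), prod_encode (Suc r, 0)} \<in> edges ?H"
      unfolding layered_graph_edge_iff using M by simp
    then show ?case using Suc by auto
  qed simp
  have "connected_graph ?H"
  proof (rule connected_graphI[OF S root])
    fix u assume "u \<in> verts ?H"
    then obtain r i where u: "u = prod_encode (r, i)" "i < M r" by (auto simp: layered_graph_def)
    show "\<exists>s. u \<in> reach ?H (prod_encode (0, 0)) s"
    proof (cases "i = 0")
      case True
      then show ?thesis using spine u by blast
    next
      case False
      then have "{prod_encode (r, 0), u} \<in> edges ?H"
        unfolding u(1) layered_graph_edge_iff using M u(2) by simp
      then have "u \<in> reach ?H (prod_encode (0, 0)) (Suc r)" using spine by auto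
      then show ?thesis by blast
    qed
  qed
  moreover have "locally_finite_graph ?H"
    unfolding locally_finite_graph_def
  proof
    fix u assume "u \<in> verts ?H"
    then obtain r i where u: "u = prod_encode (r, i)" by (auto simp: layered_graph_def)
    have "neighbours ?H u \<subseteq> prod_encode ` (SIGMA s:{..Suc r}. {..<M s})"
    proof
      fix w assume w: "w \<in> neighbours ?H u"
      obtain q where q: "w = prod_encode q" by (metis prod_decode_inverse)
      have "{prod_encode q, prod_encode (r, i)} \<in> edges ?H" using w by (simp add: neighbours_def q u)
      then have "q \<in> (SIGMA s:{..Suc r}. {..<M s})"
        unfolding layered_graph_edge_iff by (cases q) simp
      then show "w \<in> prod_encode ` (SIGMA s:{..Suc r}. {..<M s})" using q by blast
    qed
    then show "finite (neighbours ?H u)" by (rule finite_subset) auto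
  qed
  ultimately show ?thesis using S by (simp add: G_inf_def)
qed

text \<open>Distances from \<open>v\<close> differ by at most 1 along an edge, and consecutive
  layers are completely joined. Any injective placement of the distance classes in the layers from
  \<open>n\<close> on hence preserves edges. The numbering \<open>i r\<close> is taken from the
  whole ball of radius \<open>r\<close>, to match a bound on balls.\<close>

lemma embed_in_layered_graph:
  fixes G :: "nat ugraph"
  assumes G: "simple_graph G" "connected_graph G" "v \<in> verts G"
    and fin: "\<And>r. finite (reach G v r)" and bound: "\<And>r. card (reach G v r) \<le> M (n + r)"
  shows "\<exists>S. subgraph S (layered_graph M) \<and> isomorphic_graphs G S"
proof -
  have "\<forall>r. \<exists>i. i ` reach G v r \<subseteq> {..<M (n + r)} \<and> inj_on i (reach G v r)"
  proof
    fix r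
    have "card (reach G v r) \<le> card {..<M (n + r)}" using bound by simp
    then show "\<exists>i. i ` reach G v r \<subseteq> {..<M (n + r)} \<and> inj_on i (reach G v r)"
      by (rule card_le_inj[OF fin finite_lessThan])
  qed
  from choice[OF this] obtain i :: "nat \<Rightarrow> nat \<Rightarrow> nat" where
    i: "\<And>r. i r ` reach G v r \<subseteq> {..<M (n + r)}" "\<And>r. inj_on (i r) (reach G v r)" by blast
  define rk where "rk u = (LEAST r. u \<in> reach G v r)" for u
  have rk: "u \<in> reach G v (rk u)" if "u \<in> verts G" for u
    unfolding rk_def using connected_graph_reach[OF G(2,3) that] by (rule LeastI_ex)
  have rk_le: "rk w \<le> Suc (rk u)" if e: "{u, w} \<in> edges G" for u w
  proof -
    have "u \<in> reach G v (rk u)" using rk simple_graph_edgeD[OF G(1) e] by blast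
    then have "w \<in> reach G v (Suc (rk u))" using e by auto
    then show ?thesis unfolding rk_def[of w] by (rule Least_le)
  qed
  define p where "p u = (n + rk u, i (rk u) u)" for u
  define h where "h = prod_encode \<circ> p"
  have p_bound: "snd (p u) < M (fst (p u))" if "u \<in> verts G" for u
    using i(1)[of "rk u"] rk[OF that] by (auto simp: p_def)
  have p_inj: "u = w" if "u \<in> verts G" "w \<in> verts G" "p u = p w" for u w
  proof -
    have "rk u = rk w" "i (rk u) u = i (rk u) w" using that(3) by (auto simp: p_def)
    then show ?thesis using inj_onD[OF i(2), of "rk u" u w] rk[OF that(1)] rk[OF that(2)] by simp
  qed
  then have inj: "inj_on h (verts G)" by (auto simp: h_def inj_on_def prod_encode_eq)
  define S where "S = \<lparr>verts = h ` verts G, edges = (\<lambda>e. h ` e) ` edges G\<rparr>"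
  have iso: "graph_iso h G S" unfolding S_def by (rule image_graph_iso[OF inj])
  have "edges S \<subseteq> edges (layered_graph M)"
  proof
    fix e assume "e \<in> edges S"
    then obtain d where d: "d \<in> edges G" "e = h ` d" by (auto simp: S_def)
    then obtain u w where uw: "d = {u, w}" "u \<noteq> w" "u \<in> verts G" "w \<in> verts G"
      using simple_graph_edgeE[OF G(1)] by metis
    have "p u \<noteq> p w" using p_inj uw by blast
    moreover have "rk w \<le> Suc (rk u)" "rk u \<le> Suc (rk w)"
      using rk_le[of u w] rk_le[of w u] d(1) uw(1) by (simp_all add: insert_commute)
    ultimately have "{prod_encode (p u), prod_encode (p w)} \<in> edges (layered_graph M)"
      unfolding layered_graph_edge_iff using p_bound uw by (simp add: p_def)
    then show "e \<in> edges (layered_graph M)" by (simp add: d(2) uw(1) h_def)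
  qed
  moreover have "verts S \<subseteq> verts (layered_graph M)"
    using p_bound by (auto simp: S_def h_def layered_graph_vert_iff)
  ultimately have "subgraph S (layered_graph M)"
    using graph_iso_simple[OF iso G(1)] by (simp add: subgraph_def)
  then show ?thesis using iso by (auto simp: isomorphic_graphs_def)
qed

lemma contains_class_iff_bounded:
  assumes \<G>: "\<G> \<subseteq> G_inf"
  shows "(\<exists>H\<in>G_inf. contains_class H \<G>) \<longleftrightarrow>
    (\<exists>N::nat \<Rightarrow> nat \<Rightarrow> nat. \<forall>G\<in>\<G>. \<forall>v\<in>verts G. \<exists>n. \<forall>r. card (reach G v r) \<le> N n r)"
proof
  assume "\<exists>H\<in>G_inf. contains_class H \<G>"
  then obtain H where H: "simple_graph H" "locally_finite_graph H" "contains_class H \<G>"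
    by (auto simp: G_inf_def)
  have "\<exists>n. \<forall>r. card (reach G v r) \<le> card (reach H n r)" if G: "G \<in> \<G>" "v \<in> verts G" for G v
  proof -
    obtain S f where S: "subgraph S H" "graph_iso f G S"
      using H(3) G(1) unfolding contains_class_def isomorphic_graphs_def by blast
    have sG: "simple_graph G" using \<G> G(1) by (auto simp: G_inf_def)
    have inj: "inj_on f (verts G)" and im: "f ` verts G \<subseteq> verts H"
      using S by (auto simp: graph_iso_def bij_betw_def subgraph_def)
    \<comment> \<open>An embedding is injective and does not increase distances from the
      root.\<close>
    have "card (reach G v r) \<le> card (reach H (f v) r)" for r
    proof -
      have "{f x, f y} \<in> edges H" if "{x, y} \<in> edges G" for x y
        using graph_iso_edge[OF S(2) that] S(1) by (auto simp: subgraph_def)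
      then have "f ` reach G v r \<subseteq> reach H (f v) r" by (rule reach_hom)
      moreover have "inj_on f (reach G v r)"
        by (rule inj_on_subset[OF inj reach_subset[OF sG G(2)]])
      moreover have "finite (reach H (f v) r)" using H im G(2) by (intro finite_reach) auto
      ultimately show ?thesis by (intro card_inj_on_le)
    qed
    then show ?thesis by blast
  qed
  then show "\<exists>N::nat \<Rightarrow> nat \<Rightarrow> nat. \<forall>G\<in>\<G>. \<forall>v\<in>verts G. \<exists>n. \<forall>r. card (reach G v r) \<le> N n r"
    by (intro exI[of _ "\<lambda>n r. card (reach H n r)"]) blast
next
  assume "\<exists>N::nat \<Rightarrow> nat \<Rightarrow> nat. \<forall>G\<in>\<G>. \<forall>v\<in>verts G. \<exists>n. \<forall>r. card (reach G v r) \<le> N n r"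
  then obtain N :: "nat \<Rightarrow> nat \<Rightarrow> nat" where
    N: "\<And>G v. G \<in> \<G> \<Longrightarrow> v \<in> verts G \<Longrightarrow> \<exists>n. \<forall>r. card (reach G v r) \<le> N n r" by blast
  \<comment> \<open>A rooted graph with bound \<open>N n\<close> is embedded with its root in layer \<open>n\<close>.\<close>
  define M where "M r = Suc (\<Sum>n\<le>r. N n (r - n))" for r
  \<comment> \<open>In layer \<open>n + r\<close> the summand with index \<open>n\<close> is exactly
    \<open>N n r\<close>.\<close>
  have NM: "N n r \<le> M (n + r)" for n r
    using member_le_sum[of n "{..n + r}" "\<lambda>m. N m (n + r - m)"] by (simp add: M_def)
  have "contains_class (layered_graph M) \<G>"
    unfolding contains_class_def
  proof
    fix G assume G: "G \<in> \<G>"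
    then have sG: "simple_graph G" "connected_graph G" "locally_finite_graph G"
      using \<G> by (auto simp: G_inf_def)
    then obtain v where v: "v \<in> verts G" by (auto simp: connected_graph_def)
    obtain n where "\<And>r. card (reach G v r) \<le> N n r" using N[OF G v] by blast
    then have "card (reach G v r) \<le> M (n + r)" for r using NM le_trans by blast
    then show "\<exists>S. subgraph S (layered_graph M) \<and> isomorphic_graphs G S"
      using embed_in_layered_graph[OF sG(1,2) v finite_reach[OF sG(1,3) v]] by blast
  qed
  \<comment> \<open>The successor in \<open>M\<close> makes every layer nonempty.\<close>
  moreover have "layered_graph M \<in> G_inf" by (rule layered_graph_in_G_inf) (simp add: M_def)
  ultimately show "\<exists>H\<in>G_inf. contains_class H \<G>" by blast
qed

section \<open>The ball types of a graph class\<close>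

text \<open>The points of the space are isomorphism classes, so \<open>ball_type\<close> is carried
  over to them by a chosen representative; \<open>btype_class\<close> shows that the choice is
  immaterial.\<close>

definition btype :: "rgraph set \<Rightarrow> nat \<Rightarrow> ball_type" where
  "btype X r = (r, rooted_iso `` {graph_ball (SOME x. x \<in> X) r})"

definition ball_size :: "ball_type \<Rightarrow> nat" where
  "ball_size t = card (verts (fst (SOME z. z \<in> snd t)))"

lemma some_rooted_iso: "x \<in> rooted_graphs \<Longrightarrow> (x, SOME z. z \<in> rooted_iso `` {x}) \<in> rooted_iso"
  by (metis Image_singleton_iff rooted_iso_refl someI)

lemma rooted_iso_class_eq: "(x, y) \<in> rooted_iso \<Longrightarrow> rooted_iso `` {x} = rooted_iso `` {y}"
  by (rule equiv_class_eq[OF equiv_rooted_iso])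

lemma btype_class:
  assumes "x \<in> rooted_graphs"
  shows "btype (rooted_iso `` {x}) r = (r, rooted_iso `` {graph_ball x r})"
  using rooted_iso_class_eq[OF graph_ball_iso[OF some_rooted_iso[OF assms]], of r]
  by (simp add: btype_def)

lemma btype_eq_iff:
  assumes "x \<in> rooted_graphs" "y \<in> rooted_graphs"
  shows "btype (rooted_iso `` {x}) r = btype (rooted_iso `` {y}) r \<longleftrightarrow>
    (graph_ball x r, graph_ball y r) \<in> rooted_iso"
  unfolding btype_class[OF assms(1)] btype_class[OF assms(2)] prod.inject
  using eq_equiv_class_iff[OF equiv_rooted_iso graph_ball_rooted[OF assms(1)] graph_ball_rooted[OF assms(2)]]
  by simp

lemma ball_size_class:
  assumes "z \<in> rooted_graphs"
  shows "ball_size (r, rooted_iso `` {z}) = card (verts (fst z))"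
  using some_rooted_iso[OF assms]
  by (elim rooted_isoE) (auto simp: ball_size_def graph_iso_def dest: bij_betw_same_card)

lemma rooted_class_iff:
  "X \<in> rooted_class \<G> \<longleftrightarrow> (\<exists>G v. G \<in> \<G> \<and> v \<in> verts G \<and> X = rooted_iso `` {(G, v)})"
  by (auto simp: rooted_class_def quotient_def)

lemma G_inf_rooted: "G \<in> G_inf \<Longrightarrow> v \<in> verts G \<Longrightarrow> (G, v) \<in> rooted_graphs"
  by (simp add: G_inf_def rooted_graphs_def)

lemma rooted_classE:
  assumes "\<G> \<subseteq> G_inf" "X \<in> rooted_class \<G>"
  obtains G v where "G \<in> \<G>" "G \<in> G_inf" "v \<in> verts G" "(G, v) \<in> rooted_graphs" "X = rooted_iso `` {(G, v)}"
  using assms G_inf_rooted unfolding rooted_class_iff by blast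

lemma finite_graph_ball:
  assumes "G \<in> G_inf" "v \<in> verts G"
  shows "finite (verts (fst (graph_ball (G, v) r)))"
  using assms by (simp add: G_inf_def verts_graph_ball finite_reach)

lemma ball_size_btype:
  assumes "G \<in> G_inf" "v \<in> verts G"
  shows "ball_size (btype (rooted_iso `` {(G, v)}) r) = card (reach G v r)"
  using assms G_inf_rooted[OF assms]
  by (simp add: btype_class ball_size_class graph_ball_rooted verts_graph_ball G_inf_def)

text \<open>Coherence holds because balls of balls are balls. All types of radius 0 agree because
  such a ball is a single vertex, simple graphs having no loops.\<close>

lemma ball_system_rooted_class:
  assumes \<G>: "\<G> \<subseteq> G_inf"
  shows "ball_system (rooted_class \<G>) btype fst"
proof
  show "fst (btype X r) = r" for X r by (simp add: btype_def)
next
  fix X Y r assume "X \<in> rooted_class \<G>" "Y \<in> rooted_class \<G>" and eq: "btype X (Suc r) = btype Y (Suc r)"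
  then obtain x y where xy: "X = rooted_iso `` {x}" "x \<in> rooted_graphs" "Y = rooted_iso `` {y}" "y \<in> rooted_graphs"
    using rooted_classE[OF \<G>] by metis
  then have "(graph_ball x (Suc r), graph_ball y (Suc r)) \<in> rooted_iso" using eq by (simp add: btype_eq_iff)
  then have "(graph_ball (graph_ball x (Suc r)) r, graph_ball (graph_ball y (Suc r)) r) \<in> rooted_iso"
    by (rule graph_ball_iso)
  then show "btype X r = btype Y r" using xy by (simp add: btype_eq_iff graph_ball_ball)
next
  fix X Y assume "X \<in> rooted_class \<G>" "Y \<in> rooted_class \<G>"
  then obtain G v H w where X: "X = rooted_iso `` {(G, v)}" "(G, v) \<in> rooted_graphs"
    and Y: "Y = rooted_iso `` {(H, w)}" "(H, w) \<in> rooted_graphs"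
    using rooted_classE[OF \<G>] by metis
  have b0: "graph_ball (K, u) 0 = (\<lparr>verts = {u}, edges = {}\<rparr>, u)" if K: "(K, u) \<in> rooted_graphs" for K u
  proof -
    have s: "simple_graph K" "u \<in> verts K" using K by (auto simp: rooted_graphs_def)
    have "\<not> e \<subseteq> {u}" if e: "e \<in> edges K" for e
    proof -
      obtain a c where "e = {a, c}" "a \<noteq> c" using simple_graph_edgeE[OF s(1) e] by metis
      then show ?thesis by auto
    qed
    then show ?thesis using s by (auto simp: graph_ball_eq induced_subgraph_def)
  qed
  have "graph_iso (\<lambda>_. w) \<lparr>verts = {v}, edges = {}\<rparr> \<lparr>verts = {w}, edges = {}\<rparr>"
    by (simp add: graph_iso_def bij_betw_def)
  then have "(graph_ball (G, v) 0, graph_ball (H, w) 0) \<in> rooted_iso"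
    unfolding b0[OF X(2)] b0[OF Y(2)] by (rule rooted_isoI) (simp_all add: simple_graph_def)
  then show "btype X 0 = btype Y 0" using X Y by (simp add: btype_eq_iff)
qed

lemma rooted_topology_eq:
  assumes \<G>: "\<G> \<subseteq> G_inf"
  shows "rooted_topology \<G> = ball_system.cylinder_topology (rooted_class \<G>) btype"
  unfolding rooted_topology_def
proof (rule ball_system.ultrametric(2)[OF ball_system_rooted_class[OF \<G>]])
  have pre_nonneg: "0 \<le> pre_rooted_dist x y" for x y by (simp add: pre_rooted_dist_def)
  have pre_commute: "pre_rooted_dist x y = pre_rooted_dist y x" for x y
  proof -
    have "(graph_ball x r, graph_ball y r) \<in> rooted_iso \<longleftrightarrow> (graph_ball y r, graph_ball x r) \<in> rooted_iso" for r
      using rooted_iso_sym by blast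
    then show ?thesis by (simp add: pre_rooted_dist_def)
  qed
  show "0 \<le> rooted_dist X Y" for X Y by (simp add: rooted_dist_def pre_nonneg)
  show "rooted_dist X Y = rooted_dist Y X" for X Y unfolding rooted_dist_def by (rule pre_commute)
  fix X Y assume "X \<in> rooted_class \<G>" "Y \<in> rooted_class \<G>"
  then obtain G v H w where X: "G \<in> G_inf" "v \<in> verts G" "(G, v) \<in> rooted_graphs" "X = rooted_iso `` {(G, v)}"
    and Y: "H \<in> G_inf" "w \<in> verts H" "(H, w) \<in> rooted_graphs" "Y = rooted_iso `` {(H, w)}"
    using rooted_classE[OF \<G>] by metis
  show "rooted_dist X Y = (if \<forall>r. btype X r = btype Y r then 0
      else exp (- real (Max {r. btype X r = btype Y r})))"
    unfolding X(4) Y(4) rooted_dist_class[OF X(3) Y(3)] btype_eq_iff[OF X(3) Y(3)]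
    by (rule pre_rooted_dist_def)
  \<comment> \<open>Separation of points is the place where the metric needs connectedness and local
    finiteness.\<close>
  show "X = Y" if "\<And>r. btype X r = btype Y r"
    using rooted_iso_if_balls_iso[OF X(1,2) Y(1,2)] that rooted_iso_class_eq
    unfolding X(4) Y(4) btype_eq_iff[OF X(3) Y(3)] by blast
qed

text \<open>A ball with at most \<open>k\<close> vertices has a copy with labels below
  \<open>k\<close>, and there are finitely many rooted graphs on such labels.\<close>

lemma finite_ball_types_of_size:
  assumes \<G>: "\<G> \<subseteq> G_inf"
  shows "finite {t \<in> ball_system.types (rooted_class \<G>) btype. fst t = r \<and> ball_size t \<le> k}"
proof -
  let ?F = "(\<lambda>(V, E, w). (r, rooted_iso `` {(\<lparr>verts = V, edges = E\<rparr>, w)})) `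
    (Pow {..<k} \<times> Pow (Pow {..<k}) \<times> {..<k})"
  have "{t \<in> ball_system.types (rooted_class \<G>) btype. fst t = r \<and> ball_size t \<le> k} \<subseteq> ?F"
  proof
    fix t assume t: "t \<in> {t \<in> ball_system.types (rooted_class \<G>) btype. fst t = r \<and> ball_size t \<le> k}"
    then obtain X where X: "X \<in> rooted_class \<G>" "t = btype X r"
      unfolding ball_system.types_def[OF ball_system_rooted_class[OF \<G>]] by (auto simp: btype_def)
    then obtain G v where G: "G \<in> G_inf" "v \<in> verts G" "(G, v) \<in> rooted_graphs" "X = rooted_iso `` {(G, v)}"
      using rooted_classE[OF \<G>] by metis
    obtain B u where B: "graph_ball (G, v) r = (B, u)" by (cases "graph_ball (G, v) r")
    have sB: "simple_graph B" "u \<in> verts B"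
      using graph_ball_rooted[OF G(3), of r] by (auto simp: B rooted_graphs_def)
    have "finite (verts B)" using finite_graph_ball[OF G(1,2), of r] by (simp add: B)
    then obtain h where h: "bij_betw h (verts B) {0..<card (verts B)}" using ex_bij_betw_finite_nat by blast
    have "card (verts B) \<le> k"
    proof -
      have "t = (r, rooted_iso `` {(B, u)})" by (simp add: X(2) G(4) btype_class[OF G(3)] B)
      moreover have "ball_size (r, rooted_iso `` {(B, u)}) = card (verts B)"
        using ball_size_class[of "(B, u)" r] sB by (simp add: rooted_graphs_def)
      ultimately show ?thesis using t by simp
    qed
    then have hk: "h ` verts B \<subseteq> {..<k}" using h by (auto simp: bij_betw_def)
    define H where "H = \<lparr>verts = h ` verts B, edges = (\<lambda>e. h ` e) ` edges B\<rparr>"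
    have "graph_iso h B H" unfolding H_def using h by (intro image_graph_iso) (simp add: bij_betw_def)
    then have "((B, u), (H, h u)) \<in> rooted_iso" using sB by (rule rooted_isoI)
    then have "t = (r, rooted_iso `` {(H, h u)})"
      using rooted_iso_class_eq by (simp add: X(2) G btype_class B)
    moreover have "edges H \<subseteq> Pow {..<k}"
      using hk sB(1) by (auto simp: H_def simple_graph_def)
    moreover have "verts H \<subseteq> {..<k}" "h u \<in> {..<k}" using hk sB(2) by (auto simp: H_def)
    ultimately show "t \<in> ?F"
      by (intro image_eqI[of _ _ "(h ` verts B, (\<lambda>e. h ` e) ` edges B, h u)"]) (simp_all add: H_def)
  qed
  then show ?thesis by (rule finite_subset) auto
qed

text \<open>The limit exists in \<open>G_inf\<close>. Were it outside the class, some cylinder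
  around it would avoid the class by closedness, yet the cylinder of radius \<open>r\<close>
  contains \<open>z r\<close>.\<close>

lemma complete_ball_system_rooted_class:
  assumes \<G>: "\<G> \<subseteq> G_inf" and closed: "closed_graph_class \<G>"
  shows "complete_ball_system (rooted_class \<G>) btype fst ball_size"
proof -
  interpret ball_system "rooted_class \<G>" btype fst by (rule ball_system_rooted_class[OF \<G>])
  interpret I: ball_system "rooted_class G_inf" btype fst by (rule ball_system_rooted_class) simp
  show ?thesis
  proof
    fix z assume z: "\<And>r. z r \<in> rooted_class \<G>" and coherent: "\<And>r. btype (z (Suc r)) r = btype (z r) r"
    have "\<forall>r. \<exists>x. z r = rooted_iso `` {x} \<and> x \<in> rooted_graphs \<and> finite (verts (fst (graph_ball x r)))"
      using rooted_classE[OF \<G> z] finite_graph_ball by metis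
    from choice[OF this] obtain x where
      x: "\<And>r. z r = rooted_iso `` {x r}" "\<And>r. x r \<in> rooted_graphs"
        "\<And>r. finite (verts (fst (graph_ball (x r) r)))" by blast
    have "(graph_ball (x (Suc r)) r, graph_ball (x r) r) \<in> rooted_iso" for r
      using coherent[of r] unfolding x(1) btype_eq_iff[OF x(2) x(2)] .
    then obtain G v where G: "G \<in> G_inf" "v \<in> verts G"
        "\<And>r. (graph_ball (G, v) r, graph_ball (x r) r) \<in> rooted_iso"
      using limit_of_balls[OF x(2,3)] by blast
    let ?X = "rooted_iso `` {(G, v)}"
    have X: "btype ?X r = btype (z r) r" for r
      unfolding x(1) btype_eq_iff[OF G_inf_rooted[OF G(1,2)] x(2)] by (rule G(3))
    have "?X \<in> rooted_class G_inf" using G(1,2) unfolding rooted_class_iff by blast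
    moreover have "?X \<notin> rooted_class G_inf - rooted_class \<G>"
    proof
      assume X': "?X \<in> rooted_class G_inf - rooted_class \<G>"
      have "I.cylinder_open (rooted_class G_inf - rooted_class \<G>)"
        using closed unfolding closed_graph_class_def closedin_def rooted_topology_eq[OF order_refl]
        by (simp add: I.openin_cylinder_topology)
      then obtain r where "I.cylinder ?X r \<subseteq> rooted_class G_inf - rooted_class \<G>"
        using X' unfolding I.cylinder_open_def by blast
      moreover have "z r \<in> rooted_class G_inf" using z[of r] \<G> unfolding rooted_class_iff by blast
      ultimately show False using z[of r] X[of r] by (auto simp: I.cylinder_def)
    qed
    ultimately show "\<exists>x\<in>rooted_class \<G>. \<forall>r. btype x r = btype (z r) r" using X by blast
  next
    show "finite {t \<in> types. fst t = r \<and> ball_size t \<le> k}" for r k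
      by (rule finite_ball_types_of_size[OF \<G>])
  qed
qed

text \<open>The two edge sets differ by an index shift: \<open>ball_tree\<close> names an edge by
  its upper radius, \<open>type_tree\<close> by its lower one.\<close>

lemma ball_tree_eq:
  assumes \<G>: "\<G> \<subseteq> G_inf"
  shows "ball_tree \<G> = ball_system.type_tree (rooted_class \<G>) btype"
proof -
  interpret ball_system "rooted_class \<G>" btype fst by (rule ball_system_rooted_class[OF \<G>])
  have bt: "ball_type G v r = btype (rooted_iso `` {(G, v)}) r" if "G \<in> \<G>" "v \<in> verts G" for G v r
    using that \<G> by (auto simp: ball_type_def btype_class G_inf_rooted)
  have "verts (ball_tree \<G>) = types"
  proof
    show "verts (ball_tree \<G>) \<subseteq> types"
    proof
      fix t assume "t \<in> verts (ball_tree \<G>)"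
      then obtain G v r where t: "t = ball_type G v r" "G \<in> \<G>" "v \<in> verts G" by (auto simp: ball_tree_def)
      then have "rooted_iso `` {(G, v)} \<in> rooted_class \<G>" unfolding rooted_class_iff by blast
      then show "t \<in> types" unfolding types_def using bt[OF t(2,3)] t(1) by blast
    qed
    show "types \<subseteq> verts (ball_tree \<G>)"
    proof
      fix t assume "t \<in> types"
      then obtain G v r where t: "G \<in> \<G>" "v \<in> verts G" "t = btype (rooted_iso `` {(G, v)}) r"
        unfolding types_def rooted_class_iff by blast
      then have "t = ball_type G v r" using bt by simp
      then show "t \<in> verts (ball_tree \<G>)" using t(1,2) unfolding ball_tree_def ugraph.simps by blast
    qed
  qed
  moreover have "edges (ball_tree \<G>) = {{btype X r, btype X (Suc r)} | X r. X \<in> rooted_class \<G>}"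
  proof
    show "edges (ball_tree \<G>) \<subseteq> {{btype X r, btype X (Suc r)} | X r. X \<in> rooted_class \<G>}"
    proof
      fix e assume "e \<in> edges (ball_tree \<G>)"
      then obtain G v r where e: "e = {ball_type G v (r - 1), ball_type G v r}" "G \<in> \<G>" "v \<in> verts G" "r \<ge> 1"
        by (auto simp: ball_tree_def)
      then have "e = {btype (rooted_iso `` {(G, v)}) (r - 1), btype (rooted_iso `` {(G, v)}) (Suc (r - 1))}"
        using bt by simp
      moreover have "rooted_iso `` {(G, v)} \<in> rooted_class \<G>" using e unfolding rooted_class_iff by blast
      ultimately show "e \<in> {{btype X r, btype X (Suc r)} | X r. X \<in> rooted_class \<G>}" by blast
    qed
    show "{{btype X r, btype X (Suc r)} | X r. X \<in> rooted_class \<G>} \<subseteq> edges (ball_tree \<G>)"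
    proof
      fix e assume "e \<in> {{btype X r, btype X (Suc r)} | X r. X \<in> rooted_class \<G>}"
      then obtain G v r where e: "G \<in> \<G>" "v \<in> verts G"
          "e = {btype (rooted_iso `` {(G, v)}) r, btype (rooted_iso `` {(G, v)}) (Suc r)}"
        unfolding rooted_class_iff by blast
      then have "e = {ball_type G v (Suc r - 1), ball_type G v (Suc r)}" using bt by simp
      moreover have "Suc r \<ge> 1" by simp
      ultimately show "e \<in> edges (ball_tree \<G>)" using e(1,2) unfolding ball_tree_def ugraph.simps by blast
    qed
  qed
  ultimately show ?thesis by (simp add: type_tree_def)
qed

theorem theorem3p5:
  fixes \<G> :: "nat ugraph set"
  assumes "graph_class \<G>" and "\<G> \<subseteq> G_inf" and "closed_graph_class \<G>"
  shows "((\<exists>H\<in>G_inf. contains_class H \<G>) \<longleftrightarrow> sigma_compact_space (rooted_topology \<G>)) \<and>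
    (sigma_compact_space (rooted_topology \<G>) \<longleftrightarrow> \<not> contains_subdivision (ball_tree \<G>) T_inf)"
proof -
  interpret complete_ball_system "rooted_class \<G>" btype fst ball_size
    using assms(2,3) by (rule complete_ball_system_rooted_class)
  have "ball_size (btype (rooted_iso `` {(G, v)}) r) = card (reach G v r)" if "G \<in> \<G>" "v \<in> verts G" for G v r
    using that assms(2) by (intro ball_size_btype) auto
  then have "(\<forall>G\<in>\<G>. \<forall>v\<in>verts G. \<exists>n. \<forall>r. ball_size (btype (rooted_iso `` {(G, v)}) r) \<le> N n r) \<longleftrightarrow>
      (\<forall>G\<in>\<G>. \<forall>v\<in>verts G. \<exists>n. \<forall>r. card (reach G v r) \<le> N n r)" for N :: "nat \<Rightarrow> nat \<Rightarrow> nat"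
    by simp
  \<comment> \<open>Points of the space correspond to roots of members of the class, which brings
    both bounds into the same form.\<close>
  moreover have "(\<forall>X\<in>rooted_class \<G>. P X) \<longleftrightarrow> (\<forall>G\<in>\<G>. \<forall>v\<in>verts G. P (rooted_iso `` {(G, v)}))" for P
    unfolding Ball_def rooted_class_iff by blast
  ultimately have "sigma_compact_space cylinder_topology \<longleftrightarrow> (\<exists>H\<in>G_inf. contains_class H \<G>)"
    unfolding sigma_compact_iff_bounded contains_class_iff_bounded[OF assms(2)] by simp
  moreover have "sigma_compact_space cylinder_topology \<longleftrightarrow> \<not> contains_subdivision type_tree T_inf"
    using branching_imp_not_sigma_compact not_sigma_compact_imp_branching
    unfolding contains_subdivision_iff_branching by blast
  ultimately show ?thesis
    unfolding rooted_topology_eq[OF assms(2)] ball_tree_eq[OF assms(2)] by simp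
qed

end
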